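(* Let $p,q\ge1$ and $b\ge1$ be fixed integers, let $c>0$ be fixed, and let $a=cm+b$. For $\pi=(\pi_1,\dots,\pi_m)$ chosen uniformly at random from $\mathrm{PF}(a,b,m)$, as $m\to\infty$, $$\mathbb E(\pi_1^p)=\frac{((b+c)m)^p}{p+1}\left(1+\frac{1}{c(b+c)m}\left(\frac{c(p+1)}{2}-b^2p\right)+O\left(\frac1{m^2}\right)\right)$$ and $$\mathbb E(\pi_1^p\pi_2^q)=\frac{((b+c)m)^{p+q}}{(p+1)(q+1)}\left(1+\frac{1}{c(b+c)m}\left(\frac{c(p+q+2)}{2}-b^2(p+q)\right)+O\left(\frac1{m^2}\right)\right).$$
   Context: $\mathrm{PF}(a,b,m)$, for positive integers $a,b,m$, is the set of $(a,b)$-parking functions of length $m$: sequences $(\pi_1,\dots,\pi_m)$ of positive integers whose non-decreasing rearrangement $(\lambda_1,\dots,\lambda_m)$ satisfies $\lambda_i\le a+(i-1)b$ for all $1\le i\le m$. Since $a=cm+b$ must be a positive integer, $m\to\infty$ runs through values for which $cm$ is an integer. Implied constants may depend on $b,c,p,q$. *)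

theory Defs
  imports "HOL-Probability.Probability" "HOL-Library.Landau_Symbols"
begin

text \<open>
  Sequences are 0-indexed lists: the paper's \<open>\<pi>\<^sub>i\<close> is \<open>\<pi> ! (i - 1)\<close>, so the bound
  \<open>\<lambda>\<^sub>i \<le> a + (i - 1) b\<close> for \<open>1 \<le> i \<le> m\<close> reads \<open>sort \<pi> ! i \<le> a + i * b\<close> for \<open>i < m\<close>.
\<close>

definition parking_functions :: "nat \<Rightarrow> nat \<Rightarrow> nat \<Rightarrow> nat list set" where
  "parking_functions a b m =
     {\<pi>. length \<pi> = m \<and> (\<forall>x \<in> set \<pi>. x \<ge> 1) \<and> (\<forall>i < m. sort \<pi> ! i \<le> a + i * b)}"

definition pf_expectation :: "nat \<Rightarrow> nat \<Rightarrow> nat \<Rightarrow> (nat list \<Rightarrow> real) \<Rightarrow> real" where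
  "pf_expectation a b m X =
     measure_pmf.expectation (pmf_of_set (parking_functions a b m)) X"

text \<open>
  The mode of convergence \<open>m \<rightarrow> \<infinity>\<close> through those \<open>m\<close> for which \<open>c m\<close> is an integer.
  For irrational \<open>c\<close> there is no such \<open>m > 0\<close>, and the filter is \<^term>\<open>bot\<close>.
\<close>

definition at_top_int_mult :: "real \<Rightarrow> nat filter" where
  "at_top_int_mult c = inf at_top (principal {m. c * real m \<in> \<int>})"

end

theory Submission
  imports Defs
begin

text \<open>
  Write \<open>N = a + m b\<close>, which is \<open>(b + c) m + b\<close> here. If all entries but the first are given,
  forming a sequence \<open>\<rho>\<close>, then the admissible first entries are exactly \<open>1, \<dots>, W(\<rho>)\<close>
  for some \<open>W(\<rho>)\<close> (\<open>Cons_parking_iff\<close>). Summing \<open>\<pi>\<^sub>1\<^sup>p\<close> over all parking functions is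
  therefore summing the power sum \<open>1\<^sup>p + \<dots> + W(\<rho>)\<^sup>p\<close>, about
  \<open>W\<^sup>p\<^sup>+\<^sup>1 / (p + 1) + W\<^sup>p / 2\<close>, over all \<open>\<rho>\<close>: everything reduces to the power moments of \<open>W\<close>.

  Cutting \<open>\<rho>\<close> at the value \<open>W(\<rho>)\<close> splits it into a shuffle of two independent parking functions
  (\<open>tight_set_eq_shuffles\<close>), so the number of \<open>\<rho>\<close> with a given \<open>W\<close> is a product of two smaller counts
  and a binomial coefficient. The resulting sums are Abel sums. Abel's identity evaluates the simplest one,
  which gives the count \<open>a N\<^sup>m\<^sup>-\<^sup>1\<close> of all parking functions, and shows that the numbers of \<open>\<rho>\<close>,
  each weighted by \<open>W(\<rho>)\<close> and divided by \<open>a N\<^sup>m\<^sup>-\<^sup>1\<close>, define a probability law for the gap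
  \<open>T = N - W\<close>. In the limit \<open>T / b\<close> is Borel distributed with parameter \<open>b / (b + c) < 1\<close>; what is used is that
  \<open>T\<close> has mean \<open>b (b + c) / c + O(1 / m)\<close> and a bounded second moment (\<open>gap_mean_id_bounds\<close>,
  \<open>gap_mean_square_bound\<close>), both consequences of recursions for Abel sums. Hence the mean of
  \<open>(1 - T / N)\<^sup>s\<close> is \<open>1 - s b / (c m) + O(1 / m\<^sup>2)\<close>, and the first expansion follows by multiplying
  expansions of the form \<open>1 + \<alpha> / m + O(1 / m\<^sup>2)\<close>.

  For two entries, the admissible pairs for the remaining sequence \<open>\<rho>\<close> fill a square of side \<open>W\<close> from which
  the corner square \<open>(V, W] \<times> (V, W]\<close> is missing, for some \<open>V \<le> W\<close> (\<open>Cons_Cons_parking_iff\<close>). The full square involves only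
  \<open>W\<close>, and this \<open>W\<close> is the quantity studied above for the parameters \<open>a + b, b, m - 1\<close>, which have the
  same \<open>N\<close>. The joint law of \<open>V\<close> and \<open>W\<close> is never computed: the corner contributes at most
  \<open>N\<^sup>p\<^sup>+\<^sup>q\<close> times the sum of \<open>(W - V)\<^sup>2\<close>, and the case of constant functions, that is, the count of all parking functions,
  gives the exact value of that sum. It is of relative size \<open>O(1 / m\<^sup>2)\<close>, because
  the terms \<open>b / (c m)\<close> of \<open>1 + b / a\<close> and \<open>- b / (c m)\<close> of the mean of \<open>1 - T / N\<close> cancel.
\<close>

section \<open>Removing one or two entries\<close>

definition count_upto :: "nat list \<Rightarrow> nat \<Rightarrow> nat" where
  "count_upto \<rho> B = length (filter (\<lambda>x. x \<le> B) \<rho>)"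

lemma count_upto_simps [simp]:
  "count_upto [] B = 0"
  "count_upto (x # \<rho>) B = count_upto \<rho> B + (if x \<le> B then 1 else 0)"
  by (auto simp: count_upto_def)

lemma count_upto_le_length: "count_upto \<rho> B \<le> length \<rho>"
  by (simp add: count_upto_def)

text \<open>
  Turns the condition on the sorted sequence into a counting condition, which changes only by
  the new entries when entries are added.
\<close>

lemma sort_nth_le_iff:
  assumes "i < length xs"
  shows "sort xs ! i \<le> B \<longleftrightarrow> i < count_upto xs B"
proof -
  let ?ys = "sort xs"
  have len: "count_upto xs B = card {j. j < length xs \<and> ?ys ! j \<le> B}"
  proof -
    have "count_upto xs B = length (filter (\<lambda>x. x \<le> B) ?ys)"
      unfolding count_upto_def by (simp add: filter_sort)
    thus ?thesis by (simp add: length_filter_conv_card)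
  qed
  show ?thesis
  proof
    assume le: "?ys ! i \<le> B"
    have "{..i} \<subseteq> {j. j < length xs \<and> ?ys ! j \<le> B}"
    proof
      fix j assume "j \<in> {..i}"
      hence "?ys ! j \<le> ?ys ! i" "j < length xs" using assms by (auto intro!: sorted_nth_mono)
      thus "j \<in> {j. j < length xs \<and> ?ys ! j \<le> B}" using le by simp
    qed
    hence "card {..i} \<le> count_upto xs B" unfolding len by (intro card_mono) auto
    thus "i < count_upto xs B" by simp
  next
    assume i: "i < count_upto xs B"
    show "?ys ! i \<le> B"
    proof (rule ccontr)
      assume gt: "\<not> ?ys ! i \<le> B"
      have "{j. j < length xs \<and> ?ys ! j \<le> B} \<subseteq> {..<i}"
      proof
        fix j assume j: "j \<in> {j. j < length xs \<and> ?ys ! j \<le> B}"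
        have "\<not> i \<le> j"
        proof
          assume "i \<le> j"
          hence "?ys ! i \<le> ?ys ! j" using j by (intro sorted_nth_mono) auto
          thus False using j gt by simp
        qed
        thus "j \<in> {..<i}" by simp
      qed
      hence "count_upto xs B \<le> card {..<i}" unfolding len by (intro card_mono) auto
      thus False using i by simp
    qed
  qed
qed

lemma parking_functions_iff:
  "\<pi> \<in> parking_functions a b m \<longleftrightarrow>
     length \<pi> = m \<and> (\<forall>x\<in>set \<pi>. 1 \<le> x) \<and> (\<forall>i<m. i < count_upto \<pi> (a + i * b))"
  unfolding parking_functions_def using sort_nth_le_iff[of _ \<pi>] by auto

text \<open>
  The sequences that become \<open>(a, b)\<close>-parking functions when an entry \<open>1\<close> is added,
  for \<open>a \<ge> 1\<close>.
\<close>

definition almost_parking :: "nat \<Rightarrow> nat \<Rightarrow> nat \<Rightarrow> nat list set" where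
  "almost_parking a b n =
     {\<rho>. length \<rho> = n \<and> (\<forall>x\<in>set \<rho>. 1 \<le> x) \<and> (\<forall>i\<le>n. i \<le> count_upto \<rho> (a + i * b))}"

text \<open>
  The first threshold \<open>a + i b\<close> at which an almost parking sequence has no entry to spare, so that
  an additional entry must not exceed it. The count is compared by \<open>\<le>\<close> and not by equality, so that the minimum
  exists for every sequence: the length of the sequence is always such an index.
\<close>

definition tight_index :: "nat \<Rightarrow> nat \<Rightarrow> nat list \<Rightarrow> nat" where
  "tight_index a b \<rho> = (LEAST i. count_upto \<rho> (a + i * b) \<le> i)"

text \<open>
  The largest entry that can be added to an almost parking sequence, as \<open>Cons_parking_iff\<close> shows.
\<close>

definition max_free :: "nat \<Rightarrow> nat \<Rightarrow> nat list \<Rightarrow> nat" where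
  "max_free a b \<rho> = a + tight_index a b \<rho> * b"

lemma count_upto_tight_index: "count_upto \<rho> (a + tight_index a b \<rho> * b) \<le> tight_index a b \<rho>"
  unfolding tight_index_def by (rule LeastI[of _ "length \<rho>"]) (rule count_upto_le_length)

lemma tight_index_le: "count_upto \<rho> (a + i * b) \<le> i \<Longrightarrow> tight_index a b \<rho> \<le> i"
  unfolding tight_index_def by (rule Least_le)

lemma tight_index_le_length: "tight_index a b \<rho> \<le> length \<rho>"
  by (rule tight_index_le) (rule count_upto_le_length)

lemma le_max_free_iff: "x \<le> max_free a b \<rho> \<longleftrightarrow> (\<forall>i\<le>length \<rho>. count_upto \<rho> (a + i * b) \<le> i \<longrightarrow> x \<le> a + i * b)"
proof
  assume x: "x \<le> max_free a b \<rho>"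
  show "\<forall>i\<le>length \<rho>. count_upto \<rho> (a + i * b) \<le> i \<longrightarrow> x \<le> a + i * b"
  proof (intro allI impI)
    fix i assume "count_upto \<rho> (a + i * b) \<le> i"
    hence "tight_index a b \<rho> * b \<le> i * b" by (intro mult_le_mono1 tight_index_le)
    thus "x \<le> a + i * b" using x unfolding max_free_def by linarith
  qed
next
  assume "\<forall>i\<le>length \<rho>. count_upto \<rho> (a + i * b) \<le> i \<longrightarrow> x \<le> a + i * b"
  thus "x \<le> max_free a b \<rho>"
    using count_upto_tight_index tight_index_le_length unfolding max_free_def by blast
qed

lemma Cons_parking_iff:
  "x # \<rho> \<in> parking_functions a b (Suc n) \<longleftrightarrow>
     \<rho> \<in> almost_parking a b n \<and> x \<in> {1..max_free a b \<rho>}"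
proof -
  have "(\<forall>i<Suc n. i < count_upto (x # \<rho>) (a + i * b)) \<longleftrightarrow>
        (\<forall>i\<le>n. i \<le> count_upto \<rho> (a + i * b)) \<and>
        (\<forall>i\<le>n. count_upto \<rho> (a + i * b) \<le> i \<longrightarrow> x \<le> a + i * b)"
  proof -
    have "i < count_upto (x # \<rho>) (a + i * b) \<longleftrightarrow> i \<le> count_upto \<rho> (a + i * b) \<and>
        (count_upto \<rho> (a + i * b) \<le> i \<longrightarrow> x \<le> a + i * b)" for i by auto
    thus ?thesis unfolding less_Suc_eq_le by blast
  qed
  thus ?thesis
    unfolding parking_functions_iff almost_parking_def atLeastAtMost_iff le_max_free_iff by auto
qed

lemma all_Suc_iff: "P 0 \<Longrightarrow> (\<forall>i\<le>Suc n. P i) \<longleftrightarrow> (\<forall>i\<le>n. P (Suc i))"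
  by (metis Suc_le_mono not0_implies_Suc)

text \<open>
  A threshold \<open>a + i b\<close> at which \<open>\<rho>\<close> lacks two entries must be respected by both new entries, and one at
  which it lacks a single entry by at least one of them. The former thresholds are those that are tight for
  \<open>a + b\<close> in place of \<open>a\<close>, with the index shifted by one.
\<close>

lemma Cons_Cons_parking_iff:
  "x # y # \<rho> \<in> parking_functions a b (Suc (Suc n)) \<longleftrightarrow>
     \<rho> \<in> almost_parking (a + b) b n \<and> x \<in> {1..max_free (a + b) b \<rho>} \<and>
     y \<in> {1..max_free (a + b) b \<rho>} \<and> min x y \<le> max_free a b \<rho>"
proof (cases "length \<rho> = n \<and> (\<forall>z\<in>set (x # y # \<rho>). 1 \<le> z)")
  case True
  define C where "C i = count_upto \<rho> (a + i * b)" for i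
  have len: "length \<rho> = n" using True by blast
  have C_le: "C i \<le> n" for i using count_upto_le_length[of \<rho>] len by (simp add: C_def)
  have Suc_eq: "count_upto \<rho> (a + b + i * b) = C (Suc i)" for i by (simp add: C_def algebra_simps)
  have mf1: "z \<le> max_free (a + b) b \<rho> \<longleftrightarrow> (\<forall>i\<le>Suc n. C i < i \<longrightarrow> z \<le> a + i * b)" for z
    unfolding le_max_free_iff len Suc_eq by (subst all_Suc_iff) (auto simp: less_Suc_eq_le algebra_simps)
  \<comment> \<open>The index \<open>n\<close> always satisfies \<open>C n \<le> n\<close> and gives a stronger bound than the index \<open>Suc n\<close>.\<close>
  have mf0: "z \<le> max_free a b \<rho> \<longleftrightarrow> (\<forall>i\<le>Suc n. C i \<le> i \<longrightarrow> z \<le> a + i * b)" for z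
  proof -
    have "z \<le> a + Suc n * b" if "z \<le> a + n * b" using that by simp
    thus ?thesis unfolding le_max_free_iff len C_def[symmetric] using C_le[of n] by (auto simp: le_Suc_eq)
  qed
  have ap: "\<rho> \<in> almost_parking (a + b) b n \<longleftrightarrow> (\<forall>i\<le>Suc n. i \<le> Suc (C i))"
    unfolding almost_parking_def mem_Collect_eq Suc_eq using True by (subst all_Suc_iff) auto
  have "x # y # \<rho> \<in> parking_functions a b (Suc (Suc n)) \<longleftrightarrow>
      (\<forall>i\<le>Suc n. i < C i + (if x \<le> a + i * b then 1 else 0) + (if y \<le> a + i * b then 1 else 0))"
    unfolding parking_functions_iff using True by (auto simp: C_def less_Suc_eq_le)
  also have "\<dots> \<longleftrightarrow> (\<forall>i\<le>Suc n. i \<le> Suc (C i) \<and> (C i < i \<longrightarrow> x \<le> a + i * b) \<and> (C i < i \<longrightarrow> y \<le> a + i * b)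
       \<and> (C i \<le> i \<longrightarrow> min x y \<le> a + i * b))"
    by (intro all_cong1 imp_cong refl) (auto simp: min_le_iff_disj)
  also have "\<dots> \<longleftrightarrow> \<rho> \<in> almost_parking (a + b) b n \<and> x \<le> max_free (a + b) b \<rho> \<and>
       y \<le> max_free (a + b) b \<rho> \<and> min x y \<le> max_free a b \<rho>"
    unfolding mf1 mf0 ap by blast
  finally show ?thesis using True by auto
qed (auto simp: parking_functions_iff almost_parking_def)

lemma max_free_mono: "max_free a b \<rho> \<le> max_free (a + b) b \<rho>"
proof -
  have "\<forall>i\<le>length \<rho>. count_upto \<rho> (a + b + i * b) \<le> i \<longrightarrow> max_free a b \<rho> \<le> a + b + i * b"
  proof (intro allI impI)
    fix i assume "count_upto \<rho> (a + b + i * b) \<le> i"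
    hence "tight_index a b \<rho> \<le> Suc i" by (intro tight_index_le) (simp add: algebra_simps)
    hence "tight_index a b \<rho> * b \<le> Suc i * b" by (rule mult_le_mono1)
    thus "max_free a b \<rho> \<le> a + b + i * b" unfolding max_free_def by simp
  qed
  thus ?thesis using le_max_free_iff by blast
qed

section \<open>Counting almost parking sequences\<close>

lemma count_upto_eq_length_iff: "count_upto \<rho> B = length \<rho> \<longleftrightarrow> (\<forall>x\<in>set \<rho>. x \<le> B)"
  unfolding count_upto_def by (metis filter_True filter_id_conv length_filter_less less_irrefl)

lemma parking_function_le:
  assumes "\<pi> \<in> parking_functions a b m" "x \<in> set \<pi>"
  shows "x \<le> a + m * b"
proof -
  have len: "length \<pi> = m" and m: "m \<ge> 1" using assms by (auto simp: parking_functions_iff Suc_le_eq)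
  have "m - 1 < count_upto \<pi> (a + (m - 1) * b)" using assms m by (simp add: parking_functions_iff)
  hence "count_upto \<pi> (a + (m - 1) * b) = length \<pi>"
    using count_upto_le_length[of \<pi> "a + (m - 1) * b"] len by linarith
  hence "x \<le> a + (m - 1) * b" using assms by (simp add: count_upto_eq_length_iff)
  also have "\<dots> \<le> a + m * b" by simp
  finally show ?thesis .
qed

lemma finite_parking_functions: "finite (parking_functions a b m)"
proof (rule finite_subset)
  show "parking_functions a b m \<subseteq> {\<pi>. set \<pi> \<subseteq> {..a + m * b} \<and> length \<pi> = m}"
    using parking_function_le by (auto simp: parking_functions_iff)
qed (rule finite_lists_length_eq, simp)

lemma finite_almost_parking: "finite (almost_parking a b n)"
proof (rule finite_subset)
  show "almost_parking a b n \<subseteq> {\<rho>. set \<rho> \<subseteq> {..a + n * b} \<and> length \<rho> = n}"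
  proof clarify
    fix \<rho> assume \<rho>: "\<rho> \<in> almost_parking a b n"
    hence len: "length \<rho> = n" by (simp add: almost_parking_def)
    have "n \<le> count_upto \<rho> (a + n * b)" using \<rho> by (simp add: almost_parking_def)
    hence "count_upto \<rho> (a + n * b) = length \<rho>"
      using count_upto_le_length[of \<rho> "a + n * b"] len by linarith
    thus "set \<rho> \<subseteq> {..a + n * b} \<and> length \<rho> = n" using len by (auto simp: count_upto_eq_length_iff)
  qed
qed (rule finite_lists_length_eq, simp)

lemma count_upto_shuffles:
  assumes "\<rho> \<in> shuffles xs ys"
  shows "count_upto \<rho> B = count_upto xs B + count_upto ys B"
proof -
  have "filter (\<lambda>x. x \<le> B) \<rho> \<in> shuffles (filter (\<lambda>x. x \<le> B) xs) (filter (\<lambda>x. x \<le> B) ys)"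
    using assms filter_shuffles by blast
  thus ?thesis unfolding count_upto_def by (rule length_shuffles)
qed

lemma count_upto_shift: "count_upto (map ((+) B) \<tau>) (B + y) = count_upto \<tau> y"
  by (induction \<tau>) auto

text \<open>
  The decomposition behind all counts. At the tight index \<open>s\<close> exactly \<open>s\<close> entries are at most
  \<open>B = a + s b\<close>; below \<open>B\<close> no threshold is tight, so these entries form a parking function, and the
  entries above \<open>B\<close>, lowered by \<open>B\<close>, satisfy the conditions of a \<open>(b, b)\<close>-parking function.
\<close>

lemma tight_set_eq_shuffles:
  fixes a b s n :: nat
  assumes s: "s \<le> n"
  defines "B \<equiv> a + s * b"
  shows "{\<rho> \<in> almost_parking a b n. tight_index a b \<rho> = s} =
    (\<Union>(\<sigma>, \<tau>) \<in> parking_functions a b s \<times> parking_functions b b (n - s). shuffles \<sigma> (map ((+) B) \<tau>))"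
    (is "?L = ?R")
proof (intro equalityI subsetI)
  fix \<rho> assume "\<rho> \<in> ?L"
  hence len: "length \<rho> = n" and pos: "\<forall>x\<in>set \<rho>. 1 \<le> x"
    and C: "\<And>i. i \<le> n \<Longrightarrow> i \<le> count_upto \<rho> (a + i * b)" and t: "tight_index a b \<rho> = s"
    by (auto simp: almost_parking_def)
  define \<sigma> where "\<sigma> = filter (\<lambda>x. x \<le> B) \<rho>"
  define \<tau> where "\<tau> = map (\<lambda>x. x - B) (filter (\<lambda>x. \<not> x \<le> B) \<rho>)"
  have \<tau>: "map ((+) B) \<tau> = filter (\<lambda>x. \<not> x \<le> B) \<rho>"
    unfolding \<tau>_def map_map by (rule map_idI) auto
  have sh: "\<rho> \<in> shuffles \<sigma> (map ((+) B) \<tau>)"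
    unfolding \<tau> \<sigma>_def by (rule partition_in_shuffles)
  have len\<sigma>: "length \<sigma> = s"
  proof -
    have "length \<sigma> = count_upto \<rho> B" by (simp add: \<sigma>_def count_upto_def)
    thus ?thesis using count_upto_tight_index[of \<rho> a b] C[OF s] unfolding t B_def by simp
  qed
  hence len\<tau>: "length \<tau> = n - s" using length_shuffles[OF sh] len by simp
  have "\<sigma> \<in> parking_functions a b s"
    unfolding parking_functions_iff
  proof (intro conjI allI impI)
    fix i assume i: "i < s"
    have "\<not> count_upto \<rho> (a + i * b) \<le> i"
      using i unfolding t[symmetric] tight_index_def by (rule not_less_Least)
    moreover have "count_upto \<sigma> (a + i * b) = count_upto \<rho> (a + i * b)"
    proof -
      have "i * b \<le> s * b" using i by (intro mult_le_mono1) simp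
      hence "a + i * b \<le> B" unfolding B_def by simp
      thus ?thesis unfolding count_upto_def \<sigma>_def filter_filter
        by (intro arg_cong[where f = length] filter_cong) auto
    qed
    ultimately show "i < count_upto \<sigma> (a + i * b)" by simp
  qed (use len\<sigma> pos in \<open>auto simp: \<sigma>_def\<close>)
  moreover have "\<tau> \<in> parking_functions b b (n - s)"
    unfolding parking_functions_iff
  proof (intro conjI allI impI)
    fix i assume i: "i < n - s"
    have "s + Suc i \<le> count_upto \<rho> (a + (s + Suc i) * b)" using i by (intro C) simp
    also have "\<dots> = count_upto \<sigma> (a + (s + Suc i) * b) + count_upto (map ((+) B) \<tau>) (B + (b + i * b))"
      unfolding count_upto_shuffles[OF sh] by (simp add: B_def algebra_simps)
    also have "\<dots> \<le> s + count_upto \<tau> (b + i * b)"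
      unfolding count_upto_shift using count_upto_le_length[of \<sigma>] len\<sigma> by simp
    finally show "i < count_upto \<tau> (b + i * b)" by simp
  qed (use len\<tau> in \<open>auto simp: \<tau>_def\<close>)
  ultimately show "\<rho> \<in> ?R" using sh by blast
next
  fix \<rho> assume "\<rho> \<in> ?R"
  then obtain \<sigma> \<tau> where \<sigma>: "\<sigma> \<in> parking_functions a b s" and \<tau>: "\<tau> \<in> parking_functions b b (n - s)"
    and sh: "\<rho> \<in> shuffles \<sigma> (map ((+) B) \<tau>)" by blast
  have len\<sigma>: "length \<sigma> = s" and len\<tau>: "length \<tau> = n - s"
    using \<sigma> \<tau> by (auto simp: parking_functions_iff)
  have count\<sigma>: "i < count_upto \<rho> (a + i * b)" if "i < s" for i
    using \<sigma> that unfolding count_upto_shuffles[OF sh] parking_functions_iff by (simp add: trans_less_add1)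
  have count\<tau>: "count_upto \<rho> (B + j * b) = s + count_upto \<tau> (j * b)" for j
  proof -
    have "count_upto \<sigma> (B + j * b) = length \<sigma>"
      unfolding count_upto_eq_length_iff using parking_function_le[OF \<sigma>] by (auto simp: B_def trans_le_add1)
    thus ?thesis unfolding count_upto_shuffles[OF sh] count_upto_shift using len\<sigma> by simp
  qed
  have "\<rho> \<in> almost_parking a b n"
    unfolding almost_parking_def mem_Collect_eq
  proof (intro conjI allI impI)
    show "length \<rho> = n" using length_shuffles[OF sh] len\<sigma> len\<tau> s by simp
    show "\<forall>x\<in>set \<rho>. 1 \<le> x"
      using set_shuffles[OF sh] \<sigma> \<tau> by (auto simp: parking_functions_iff trans_le_add2)
    fix i assume i: "i \<le> n"
    show "i \<le> count_upto \<rho> (a + i * b)"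
    proof (cases "i < s")
      case True thus ?thesis using count\<sigma> by (simp add: less_imp_le)
    next
      case False
      define j where "j = i - s"
      have eq: "a + i * b = B + j * b" using False by (simp add: B_def j_def algebra_simps flip: add_mult_distrib)
      have "j \<le> count_upto \<tau> (j * b)"
        using \<tau> i False unfolding parking_functions_iff j_def
        by (cases "i - s") (auto simp: Suc_le_eq)
      thus ?thesis unfolding eq count\<tau> j_def using False by simp
    qed
  qed
  moreover have "tight_index a b \<rho> = s"
    unfolding tight_index_def
  proof (rule Least_equality)
    have "count_upto \<tau> 0 = 0"
      using \<tau> by (auto simp: parking_functions_iff count_upto_def filter_empty_conv)
    thus "count_upto \<rho> (a + s * b) \<le> s" using count\<tau>[of 0] by (simp add: B_def)
    show "s \<le> i" if "count_upto \<rho> (a + i * b) \<le> i" for i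
      using that count\<sigma>[of i] by (meson not_le)
  qed
  ultimately show "\<rho> \<in> ?L" by simp
qed

text \<open>
  The two parts can be read off from the shuffle by comparing the entries with \<open>B\<close>, so the shuffle sets are
  disjoint.
\<close>

lemma card_tight_set:
  assumes s: "s \<le> n"
  shows "card {\<rho> \<in> almost_parking a b n. tight_index a b \<rho> = s} =
    (n choose s) * card (parking_functions a b s) * card (parking_functions b b (n - s))"
proof -
  define B where "B = a + s * b"
  define P where "P = parking_functions a b s \<times> parking_functions b b (n - s)"
  define sh where "sh = (\<lambda>(\<sigma>, \<tau>). shuffles \<sigma> (map ((+) B) \<tau>))"
  have low: "x \<le> B" if "\<sigma> \<in> parking_functions a b s" "x \<in> set \<sigma>" for \<sigma> x
    using parking_function_le[OF that] by (simp add: B_def)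
  have high: "\<not> x \<le> B" if \<tau>: "\<tau> \<in> parking_functions b b (n - s)" and x: "x \<in> set (map ((+) B) \<tau>)" for \<tau> x
  proof -
    obtain y where "y \<in> set \<tau>" "x = B + y" using x by auto
    moreover from this have "1 \<le> y" using \<tau> by (auto simp: parking_functions_iff)
    ultimately show ?thesis by simp
  qed
  have part: "partition (\<lambda>x. x \<le> B) -` {(\<sigma>, map ((+) B) \<tau>)} = sh (\<sigma>, \<tau>)" if "(\<sigma>, \<tau>) \<in> P" for \<sigma> \<tau>
    unfolding sh_def prod.case using that low high unfolding P_def by (intro inv_image_partition) blast+
  have card_sh: "card (sh p) = n choose s" if "p \<in> P" for p
  proof -
    obtain \<sigma> \<tau> where p: "p = (\<sigma>, \<tau>)" by (cases p)
    have "set \<sigma> \<inter> set (map ((+) B) \<tau>) = {}"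
      using that low high unfolding P_def p by blast
    moreover have "length \<sigma> = s" "length \<tau> = n - s"
      using that unfolding P_def p by (auto simp: parking_functions_iff)
    ultimately show ?thesis using s unfolding p sh_def prod.case by (subst card_disjoint_shuffles) auto
  qed
  have disj: "sh p \<inter> sh q = {}" if "p \<in> P" "q \<in> P" "p \<noteq> q" for p q
  proof -
    obtain \<sigma> \<tau> \<sigma>' \<tau>' where pq: "p = (\<sigma>, \<tau>)" "q = (\<sigma>', \<tau>')" by (cases p, cases q)
    have "(\<sigma>, map ((+) B) \<tau>) \<noteq> (\<sigma>', map ((+) B) \<tau>')"
      using that(3) unfolding pq by (auto simp: inj_map_eq_map[OF inj_on_add])
    moreover have "partition (\<lambda>x. x \<le> B) \<rho> = (\<sigma>, map ((+) B) \<tau>)" if "\<rho> \<in> sh (\<sigma>, \<tau>)" for \<rho>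
      using part[of \<sigma> \<tau>] that \<open>p \<in> P\<close> unfolding pq by blast
    moreover have "partition (\<lambda>x. x \<le> B) \<rho> = (\<sigma>', map ((+) B) \<tau>')" if "\<rho> \<in> sh (\<sigma>', \<tau>')" for \<rho>
      using part[of \<sigma>' \<tau>'] that \<open>q \<in> P\<close> unfolding pq by blast
    ultimately show ?thesis unfolding pq by (metis disjoint_iff)
  qed
  have "card (\<Union>p\<in>P. sh p) = (\<Sum>p\<in>P. card (sh p))"
    by (rule card_UN_disjoint) (use disj in \<open>auto simp: P_def finite_parking_functions sh_def\<close>)
  also have "\<dots> = card P * (n choose s)" using card_sh by simp
  finally show ?thesis
    unfolding tight_set_eq_shuffles[OF s] B_def[symmetric] P_def[symmetric] sh_def[symmetric]
    by (simp add: P_def card_cartesian_product)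
qed

lemma sum_max_free:
  fixes \<psi> :: "real \<Rightarrow> real"
  shows "(\<Sum>\<rho>\<in>almost_parking a b n. \<psi> (real (max_free a b \<rho>))) =
    (\<Sum>s\<le>n. real (n choose s) * card (parking_functions a b s) * card (parking_functions b b (n - s)) *
       \<psi> (real (a + s * b)))"
proof -
  have "(\<Sum>\<rho>\<in>almost_parking a b n. \<psi> (real (max_free a b \<rho>))) =
      (\<Sum>s\<le>n. \<Sum>\<rho>\<in>{\<rho> \<in> almost_parking a b n. tight_index a b \<rho> = s}. \<psi> (real (max_free a b \<rho>)))"
  proof (rule sum.group[symmetric])
    show "tight_index a b ` almost_parking a b n \<subseteq> {..n}"
      using tight_index_le_length by (fastforce simp: almost_parking_def)
  qed (auto simp: finite_almost_parking)
  also have "\<dots> = (\<Sum>s\<le>n. \<Sum>\<rho>\<in>{\<rho> \<in> almost_parking a b n. tight_index a b \<rho> = s}. \<psi> (real (a + s * b)))"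
    by (intro sum.cong refl) (auto simp: max_free_def)
  also have "\<dots> = (\<Sum>s\<le>n. real (n choose s) * card (parking_functions a b s) * card (parking_functions b b (n - s)) *
       \<psi> (real (a + s * b)))"
    by (intro sum.cong refl) (simp add: card_tight_set)
  finally show ?thesis .
qed

lemma sum_parking_functions_first:
  fixes f :: "nat \<Rightarrow> real"
  shows "(\<Sum>\<pi>\<in>parking_functions a b (Suc n). f (\<pi> ! 0)) =
    (\<Sum>\<rho>\<in>almost_parking a b n. \<Sum>x=1..max_free a b \<rho>. f x)"
proof -
  have "parking_functions a b (Suc n) = (\<lambda>(\<rho>, x). x # \<rho>) ` (SIGMA \<rho>:almost_parking a b n. {1..max_free a b \<rho>})"
  proof (intro equalityI subsetI)
    fix \<pi> assume \<pi>: "\<pi> \<in> parking_functions a b (Suc n)"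
    then obtain x \<rho> where eq: "\<pi> = x # \<rho>"
      by (cases \<pi>) (auto simp: parking_functions_iff)
    have "(\<rho>, x) \<in> (SIGMA \<rho>:almost_parking a b n. {1..max_free a b \<rho>})"
      using \<pi> unfolding eq Cons_parking_iff by simp
    thus "\<pi> \<in> (\<lambda>(\<rho>, x). x # \<rho>) ` (SIGMA \<rho>:almost_parking a b n. {1..max_free a b \<rho>})"
      unfolding eq by (rule rev_image_eqI) simp
  qed (auto simp: Cons_parking_iff)
  moreover have "inj_on (\<lambda>(\<rho>, x). x # \<rho>) A" for A :: "(nat list \<times> nat) set"
    by (auto simp: inj_on_def)
  ultimately show ?thesis
    by (simp add: sum.reindex sum.Sigma finite_almost_parking case_prod_unfold)
qed

lemma sum_square_minus_corner:
  fixes f g :: "nat \<Rightarrow> real"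
  assumes "v \<le> w"
  shows "(\<Sum>(x, y) \<in> {(x, y). x \<in> {1..w} \<and> y \<in> {1..w} \<and> min x y \<le> v}. f x * g y) =
    sum f {1..w} * sum g {1..w} -
    (sum f {1..w} - sum f {1..v}) * (sum g {1..w} - sum g {1..v})"
proof -
  have tail: "sum h {1..w} - sum h {1..v} = sum h {v<..w}" for h :: "nat \<Rightarrow> real"
  proof -
    have "{1..w} = {1..v} \<union> {v<..w}" using assms by auto
    moreover have "{1..v} \<inter> {v<..w} = {}" by auto
    ultimately show ?thesis by (simp add: sum.union_disjoint)
  qed
  have "{(x, y). x \<in> {1..w} \<and> y \<in> {1..w} \<and> min x y \<le> v} =
      {1..w} \<times> {1..w} - {v<..w} \<times> {v<..w}"
    by (auto simp: min_le_iff_disj)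
  moreover have "{v<..w} \<times> {v<..w} \<subseteq> {1..w} \<times> {1..w}" by auto
  ultimately show ?thesis unfolding tail sum_product sum.cartesian_product
    by (simp add: sum_diff)
qed

lemma sum_parking_functions_first_two:
  fixes f g :: "nat \<Rightarrow> real"
  shows "(\<Sum>\<pi>\<in>parking_functions a b (Suc (Suc n)). f (\<pi> ! 0) * g (\<pi> ! 1)) =
    (\<Sum>\<rho>\<in>almost_parking (a + b) b n.
       sum f {1..max_free (a + b) b \<rho>} * sum g {1..max_free (a + b) b \<rho>} -
       (sum f {1..max_free (a + b) b \<rho>} - sum f {1..max_free a b \<rho>}) *
       (sum g {1..max_free (a + b) b \<rho>} - sum g {1..max_free a b \<rho>}))"
proof -
  define D where "D \<rho> = {(x, y). x \<in> {1..max_free (a + b) b \<rho>} \<and> y \<in> {1..max_free (a + b) b \<rho>} \<and>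
    min x y \<le> max_free a b \<rho>}" for \<rho>
  have fin: "finite (D \<rho>)" for \<rho>
    by (rule finite_subset[of _ "{1..max_free (a + b) b \<rho>} \<times> {1..max_free (a + b) b \<rho>}"]) (auto simp: D_def)
  have "parking_functions a b (Suc (Suc n)) = (\<lambda>(\<rho>, x, y). x # y # \<rho>) ` Sigma (almost_parking (a + b) b n) D"
  proof (intro equalityI subsetI)
    fix \<pi> assume \<pi>: "\<pi> \<in> parking_functions a b (Suc (Suc n))"
    then obtain x y \<rho> where eq: "\<pi> = x # y # \<rho>"
      by (cases \<pi>; cases "tl \<pi>") (auto simp: parking_functions_iff)
    have "(\<rho>, x, y) \<in> Sigma (almost_parking (a + b) b n) D"
      using \<pi> unfolding eq Cons_Cons_parking_iff D_def by simp
    thus "\<pi> \<in> (\<lambda>(\<rho>, x, y). x # y # \<rho>) ` Sigma (almost_parking (a + b) b n) D"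
      unfolding eq by (rule rev_image_eqI) simp
  qed (auto simp: Cons_Cons_parking_iff D_def)
  moreover have "inj_on (\<lambda>(\<rho>, x, y). x # y # \<rho>) A" for A :: "(nat list \<times> nat \<times> nat) set"
    by (auto simp: inj_on_def)
  ultimately have "(\<Sum>\<pi>\<in>parking_functions a b (Suc (Suc n)). f (\<pi> ! 0) * g (\<pi> ! 1)) =
      (\<Sum>\<rho>\<in>almost_parking (a + b) b n. \<Sum>(x, y)\<in>D \<rho>. f x * g y)"
    by (simp add: sum.reindex sum.Sigma finite_almost_parking fin case_prod_unfold)
  thus ?thesis unfolding D_def sum_square_minus_corner[OF max_free_mono] .
qed

section \<open>Abel sums\<close>

text \<open>
  The sum in Abel's binomial identity, with a test function of the node \<open>t = x + k z\<close>. The sum of the two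
  bases is the fixed parameter \<open>S\<close>, so that shifting \<open>x\<close> by \<open>z\<close> and lowering \<open>n\<close> are the only changes in the recursions below.
\<close>

definition abel_sum :: "real \<Rightarrow> real \<Rightarrow> nat \<Rightarrow> real \<Rightarrow> (real \<Rightarrow> real) \<Rightarrow> real" where
  "abel_sum z S n x \<phi> =
     (\<Sum>k\<le>n. real (n choose k) * (x + real k * z) ^ k * (S - (x + real k * z)) ^ (n - k) * \<phi> (x + real k * z))"

lemma abel_sum_0 [simp]: "abel_sum z S 0 x \<phi> = \<phi> x"
  by (simp add: abel_sum_def)

text \<open>
  Split a factor \<open>t = x + k z\<close> and absorb \<open>k\<close> into the binomial coefficient.
\<close>

lemma abel_sum_Suc_mult:
  "abel_sum z S (Suc n) x (\<lambda>t. t * \<phi> t) =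
     x * abel_sum z S (Suc n) x \<phi> + z * real (Suc n) * abel_sum z S n (x + z) (\<lambda>t. t * \<phi> t)"
proof -
  define h where "h k = (x + real k * z) ^ k * (S - (x + real k * z)) ^ (Suc n - k) * \<phi> (x + real k * z)" for k
  have "abel_sum z S (Suc n) x (\<lambda>t. t * \<phi> t) = (\<Sum>k\<le>Suc n. real (Suc n choose k) * h k * (x + real k * z))"
    unfolding abel_sum_def h_def by (intro sum.cong) (simp_all add: mult_ac)
  also have "\<dots> = x * (\<Sum>k\<le>Suc n. real (Suc n choose k) * h k) + z * (\<Sum>k\<le>Suc n. real (k * (Suc n choose k)) * h k)"
    by (simp only: sum_distrib_left flip: sum.distrib) (intro sum.cong, simp_all add: algebra_simps)
  also have "(\<Sum>k\<le>Suc n. real (Suc n choose k) * h k) = abel_sum z S (Suc n) x \<phi>"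
    unfolding abel_sum_def h_def by (intro sum.cong) (simp_all add: mult_ac)
  also have "(\<Sum>k\<le>Suc n. real (k * (Suc n choose k)) * h k) = (\<Sum>k\<le>n. real (Suc k * (Suc n choose Suc k)) * h (Suc k))"
    by (subst sum.atMost_Suc_shift) simp
  also have "\<dots> = real (Suc n) * abel_sum z S n (x + z) (\<lambda>t. t * \<phi> t)"
  proof -
    have shift: "x + real (Suc k) * z = x + z + real k * z" for k by (simp add: algebra_simps)
    show ?thesis
      unfolding abel_sum_def h_def sum_distrib_left Suc_times_binomial shift of_nat_mult
      by (intro sum.cong) (simp_all add: mult_ac)
  qed
  finally show ?thesis by (simp add: mult_ac)
qed

lemma sum_binomial_Suc:
  fixes h :: "nat \<Rightarrow> real"
  shows "(\<Sum>k\<le>Suc n. real (Suc n choose k) * h k) =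
    (\<Sum>k\<le>n. real (n choose k) * h k) + (\<Sum>k\<le>n. real (n choose k) * h (Suc k))"
proof -
  have "(\<Sum>k\<le>Suc n. real (Suc n choose k) * h k) =
      h 0 + (\<Sum>k\<le>n. real (n choose Suc k) * h (Suc k)) + (\<Sum>k\<le>n. real (n choose k) * h (Suc k))"
    by (subst sum.atMost_Suc_shift) (simp add: algebra_simps sum.distrib)
  also have "h 0 + (\<Sum>k\<le>n. real (n choose Suc k) * h (Suc k)) = (\<Sum>k\<le>Suc n. real (n choose k) * h k)"
    by (subst sum.atMost_Suc_shift) simp
  also have "\<dots> = (\<Sum>k\<le>n. real (n choose k) * h k)" by simp
  finally show ?thesis .
qed

text \<open>
  Pascal's rule; in the first part a factor \<open>S - t\<close> is split off, in the second one a factor \<open>t\<close> cancels.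
\<close>

lemma abel_sum_Suc_inverse:
  assumes "x > 0" "z \<ge> 0"
  shows "abel_sum z S (Suc n) x inverse =
    S * abel_sum z S n x inverse - abel_sum z S n x (\<lambda>_. 1) + abel_sum z S n (x + z) (\<lambda>_. 1)"
proof -
  define t where "t k = x + real k * z" for k
  have t: "t k > 0" for k using assms by (simp add: t_def add_pos_nonneg)
  define h where "h k = t k ^ k * (S - t k) ^ (Suc n - k) * inverse (t k)" for k
  have "abel_sum z S (Suc n) x inverse = (\<Sum>k\<le>Suc n. real (Suc n choose k) * h k)"
    unfolding abel_sum_def h_def t_def by (intro sum.cong) (simp_all add: mult_ac)
  also have "\<dots> = (\<Sum>k\<le>n. real (n choose k) * h k) + (\<Sum>k\<le>n. real (n choose k) * h (Suc k))"
    by (rule sum_binomial_Suc)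
  also have "(\<Sum>k\<le>n. real (n choose k) * h k) = S * abel_sum z S n x inverse - abel_sum z S n x (\<lambda>_. 1)"
    unfolding abel_sum_def t_def[symmetric] sum_distrib_left sum_subtractf[symmetric]
  proof (rule sum.cong)
    fix k assume "k \<in> {..n}"
    hence "Suc n - k = Suc (n - k)" by auto
    thus "real (n choose k) * h k = S * (real (n choose k) * t k ^ k * (S - t k) ^ (n - k) * inverse (t k)) -
       real (n choose k) * t k ^ k * (S - t k) ^ (n - k) * 1"
      using t[of k] by (simp add: h_def field_simps)
  qed simp
  also have "(\<Sum>k\<le>n. real (n choose k) * h (Suc k)) = abel_sum z S n (x + z) (\<lambda>_. 1)"
    unfolding abel_sum_def
  proof (rule sum.cong)
    fix k
    have "x + z + real k * z = t (Suc k)" by (simp add: t_def algebra_simps)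
    thus "real (n choose k) * h (Suc k) =
      real (n choose k) * (x + z + real k * z) ^ k * (S - (x + z + real k * z)) ^ (n - k) * 1"
      using t[of "Suc k"] by (simp add: h_def)
  qed simp
  finally show ?thesis .
qed

lemma abel_sum_one_Suc_shift:
  assumes "x > 0" "z \<ge> 0"
  shows "abel_sum z S (Suc n) x (\<lambda>_. 1) =
    x * abel_sum z S (Suc n) x inverse + z * real (Suc n) * abel_sum z S n (x + z) (\<lambda>_. 1)"
proof -
  have "abel_sum z S m y (\<lambda>t. t * inverse t) = abel_sum z S m y (\<lambda>_. 1)" if "y > 0" for m y
  proof -
    have "y + real k * z \<noteq> 0" for k
      using \<open>y > 0\<close> \<open>z \<ge> 0\<close> by (metis add_pos_nonneg less_irrefl mult_nonneg_nonneg of_nat_0_le_iff)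
    thus ?thesis unfolding abel_sum_def by (intro sum.cong) auto
  qed
  thus ?thesis using abel_sum_Suc_mult[of z S n x inverse] assms by (simp add: add_pos_nonneg)
qed

text \<open>
  Both statements need each other in the induction: if the Abel sum of \<open>1\<close> is independent of \<open>x\<close>, then the last two
  terms of \<open>abel_sum_Suc_inverse\<close> cancel; and once the Abel sum of \<open>1 / t\<close> is known, the recursion
  \<open>abel_sum_one_Suc_shift\<close> no longer depends on \<open>x\<close>.
\<close>

lemma abel_sum_inverse_and_one:
  assumes "z \<ge> 0"
  shows "(\<forall>x>0. abel_sum z S n x inverse = S ^ n / x) \<and>
         (\<forall>x>0. \<forall>y>0. abel_sum z S n x (\<lambda>_. 1) = abel_sum z S n y (\<lambda>_. 1))"
proof (induction n)
  case 0
  show ?case by (simp add: divide_inverse)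
next
  case (Suc n)
  hence IH_inv: "\<And>x. x > 0 \<Longrightarrow> abel_sum z S n x inverse = S ^ n / x"
    and IH_one: "\<And>x y. x > 0 \<Longrightarrow> y > 0 \<Longrightarrow> abel_sum z S n x (\<lambda>_. 1) = abel_sum z S n y (\<lambda>_. 1)"
    by blast+
  have inv: "abel_sum z S (Suc n) x inverse = S ^ Suc n / x" if "x > 0" for x
  proof -
    have "abel_sum z S n x (\<lambda>_. 1) = abel_sum z S n (x + z) (\<lambda>_. 1)"
      using that assms by (intro IH_one) auto
    thus ?thesis using that assms by (simp add: abel_sum_Suc_inverse IH_inv)
  qed
  have "abel_sum z S (Suc n) x (\<lambda>_. 1) = S ^ Suc n + z * real (Suc n) * abel_sum z S n 1 (\<lambda>_. 1)" if "x > 0" for x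
  proof -
    have "abel_sum z S n (x + z) (\<lambda>_. 1) = abel_sum z S n 1 (\<lambda>_. 1)"
      using that assms by (intro IH_one) auto
    thus ?thesis using that assms by (simp add: abel_sum_one_Suc_shift inv)
  qed
  thus ?case using inv by simp
qed

lemma abel_identity:
  "z \<ge> 0 \<Longrightarrow> x > 0 \<Longrightarrow> abel_sum z S n x inverse = S ^ n / x"
  using abel_sum_inverse_and_one by blast

lemma abel_sum_one_Suc:
  assumes "z \<ge> 0" "x > 0"
  shows "abel_sum z S (Suc n) x (\<lambda>_. 1) = S ^ Suc n + z * real (Suc n) * abel_sum z S n x (\<lambda>_. 1)"
proof -
  have "abel_sum z S n (x + z) (\<lambda>_. 1) = abel_sum z S n x (\<lambda>_. 1)"
    using abel_sum_inverse_and_one[OF assms(1)] assms add_pos_nonneg[OF assms(2,1)] by blast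
  thus ?thesis using assms by (simp add: abel_sum_one_Suc_shift abel_identity)
qed

text \<open>
  If \<open>n\<close> were constant in the recursion \<open>abel_sum_one_Suc\<close>, divided by \<open>S\<^sup>n\<close>, its fixed point would be
  \<open>S / (S - n z)\<close>. As \<open>n\<close> decreases along the recursion, this value is an upper bound.
\<close>

lemma abel_sum_one_upper:
  assumes "z \<ge> 0" "x > 0" "real n * z < S"
  shows "abel_sum z S n x (\<lambda>_. 1) \<le> S ^ n * (S / (S - real n * z))"
  using assms
proof (induction n)
  case (Suc n)
  define d where "d = S - real (Suc n) * z"
  have d: "d > 0" using Suc.prems by (simp add: d_def)
  have dz: "S - real n * z = d + z" by (simp add: d_def algebra_simps)
  have S: "S > 0" using Suc.prems by (smt (verit) mult_nonneg_nonneg of_nat_0_le_iff)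
  have "abel_sum z S n x (\<lambda>_. 1) \<le> S ^ n * (S / (d + z))"
    using Suc d unfolding dz[symmetric] by (smt (verit) dz)
  also have "\<dots> \<le> S ^ n * (S / d)"
    using S d Suc.prems by (intro mult_left_mono divide_left_mono) auto
  finally have "abel_sum z S (Suc n) x (\<lambda>_. 1) \<le> S ^ Suc n + z * real (Suc n) * (S ^ n * (S / d))"
    using Suc.prems by (simp only: abel_sum_one_Suc) (intro add_left_mono mult_left_mono, auto)
  also have "\<dots> = S ^ Suc n * (1 + z * real (Suc n) / d)" by (simp add: distrib_left mult_ac)
  also have "1 + z * real (Suc n) / d = S / d" using d by (simp add: field_simps d_def)
  finally show ?case unfolding d_def .
qed simp

text \<open>
  The defect \<open>e\<^sub>n\<close> from the fixed point satisfies
  \<open>e\<^sub>n = (n z / S) (e\<^sub>n\<^sub>-\<^sub>1 + z S / (d (d + z)))\<close> with \<open>d = S - n z\<close>, and \<open>n z\<^sup>2 S / d\<^sup>3\<close> is a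
  supersolution of this recursion.
\<close>

lemma abel_sum_one_lower:
  assumes "z \<ge> 0" "x > 0" "real n * z < S"
  shows "S ^ n * (S / (S - real n * z) - real n * z ^ 2 * S / (S - real n * z) ^ 3) \<le> abel_sum z S n x (\<lambda>_. 1)"
  using assms
proof (induction n)
  case (Suc n)
  define d where "d = S - real (Suc n) * z"
  have d: "d > 0" using Suc.prems by (simp add: d_def)
  have dz: "S - real n * z = d + z" by (simp add: d_def algebra_simps)
  have S: "S > 0" using Suc.prems by (smt (verit) mult_nonneg_nonneg of_nat_0_le_iff)
  define y where "y = real (Suc n) * z"
  have y: "y \<ge> 0" "S = d + y" using Suc.prems by (auto simp: y_def d_def)
  define e where "e = z * S / d ^ 2 + y * z * S / d ^ 3"
  have e: "S / d - e \<le> S / (d + z) - real n * z ^ 2 * S / (d + z) ^ 3"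
  proof -
    have "S / d - S / (d + z) = z * S / (d * (d + z))"
      using d Suc.prems by (simp add: field_simps)
    also have "\<dots> \<le> z * S / d ^ 2"
      using d S Suc.prems by (intro divide_left_mono) (auto simp: power2_eq_square)
    finally have "S / d - S / (d + z) \<le> z * S / d ^ 2" .
    moreover have "real n * z ^ 2 * S / (d + z) ^ 3 \<le> y * z * S / d ^ 3"
    proof (rule frac_le)
      show "real n * z\<^sup>2 * S \<le> y * z * S"
        using S Suc.prems by (auto simp: y_def power2_eq_square algebra_simps)
    qed (use d S Suc.prems y in \<open>auto intro!: power_mono\<close>)
    ultimately show ?thesis by (simp add: e_def)
  qed
  have "S ^ n * (S / d - e) \<le> S ^ n * (S / (d + z) - real n * z ^ 2 * S / (d + z) ^ 3)"
    using S e by (intro mult_left_mono) auto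
  also have "\<dots> \<le> abel_sum z S n x (\<lambda>_. 1)"
    using Suc d unfolding dz[symmetric] by (smt (verit) dz)
  finally have "S ^ Suc n + y * (S ^ n * (S / d - e)) \<le> S ^ Suc n + y * abel_sum z S n x (\<lambda>_. 1)"
    using y by (intro add_left_mono mult_left_mono)
  also have "\<dots> = abel_sum z S (Suc n) x (\<lambda>_. 1)"
    using Suc.prems by (simp only: abel_sum_one_Suc y_def) simp
  also have "S ^ Suc n + y * (S ^ n * (S / d - e)) = S ^ n * (S + y * S / d - y * e)"
    by (simp add: algebra_simps)
  also have "S + y * S / d = S * (S / d)" using d y by (simp add: field_simps)
  also have "S * (S / d) - y * e = S * (S / d) - S * (y * z * S / d ^ 3)"
  proof -
    have "e = z * S / d ^ 3 * (d + y)"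
      using d by (simp add: e_def field_simps power2_eq_square power3_eq_cube)
    thus ?thesis using y by simp
  qed
  also have "S ^ n * (S * (S / d) - S * (y * z * S / d ^ 3)) = S ^ Suc n * (S / d - y * z * S / d ^ 3)"
    by (simp add: algebra_simps)
  also have "y * z * S = real (Suc n) * z ^ 2 * S" by (simp add: y_def power2_eq_square)
  finally show ?case unfolding d_def .
qed simp

text \<open>
  The shape of the bound is the one for which the recursion closes with equality when \<open>n z / S\<close> is replaced by
  a constant.
\<close>

lemma abel_sum_id_upper:
  assumes "z \<ge> 0" "x > 0" "real n * z < S"
  shows "abel_sum z S n x (\<lambda>t. t) \<le>
    S ^ n * ((x + real n * z ^ 2 / (S - real n * z)) * (S / (S - real n * z)) ^ 2)"
  using assms
proof (induction n arbitrary: x)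
  case 0
  thus ?case by simp
next
  case (Suc n)
  define d where "d = S - real (Suc n) * z"
  have d: "d > 0" using Suc.prems by (simp add: d_def)
  have dz: "S - real n * z = d + z" by (simp add: d_def algebra_simps)
  have S: "S > 0" using Suc.prems by (smt (verit) mult_nonneg_nonneg of_nat_0_le_iff)
  define y where "y = real (Suc n) * z"
  have y: "y \<ge> 0" "S = d + y" using Suc.prems by (auto simp: y_def d_def)
  have xz: "x + z > 0" using Suc.prems by simp
  have "real n * z < S" using dz d Suc.prems by linarith
  hence "abel_sum z S n (x + z) (\<lambda>t. t) \<le> S ^ n * ((x + z + real n * z ^ 2 / (d + z)) * (S / (d + z)) ^ 2)"
    using Suc.IH[OF Suc.prems(1) xz] unfolding dz by blast
  also have "\<dots> \<le> S ^ n * ((x + z + y * z / d) * (S / d) ^ 2)"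
  proof -
    have "real n * z ^ 2 / (d + z) \<le> y * z / d"
    proof (rule frac_le)
      show "real n * z\<^sup>2 \<le> y * z"
        using Suc.prems by (auto simp: y_def power2_eq_square algebra_simps)
    qed (use d Suc.prems y in auto)
    moreover have "S / (d + z) \<le> S / d" using d S Suc.prems by (intro divide_left_mono) auto
    moreover have "0 \<le> S / (d + z)" "0 \<le> real n * z ^ 2 / (d + z)" using d S Suc.prems by auto
    ultimately show ?thesis
      using S xz by (intro mult_left_mono mult_mono power_mono add_left_mono) auto
  qed
  finally have IH: "abel_sum z S n (x + z) (\<lambda>t. t) \<le> S ^ n * ((x + z + y * z / d) * (S / d) ^ 2)" .
  have one: "abel_sum z S (Suc n) x (\<lambda>_. 1) \<le> S ^ Suc n * (S / d)"
    using abel_sum_one_upper[OF Suc.prems] unfolding d_def .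
  have "abel_sum z S (Suc n) x (\<lambda>t. t) = x * abel_sum z S (Suc n) x (\<lambda>_. 1) + y * abel_sum z S n (x + z) (\<lambda>t. t)"
    using abel_sum_Suc_mult[of z S n x "\<lambda>_. 1"] by (simp add: y_def mult.commute)
  also have "\<dots> \<le> x * (S ^ Suc n * (S / d)) + y * (S ^ n * ((x + z + y * z / d) * (S / d) ^ 2))"
    using one IH y Suc.prems by (intro add_mono mult_left_mono) auto
  also have "\<dots> = S ^ Suc n * ((x + y * z / d) * (S / d) ^ 2)"
  proof -
    have "S * (S * x / d) + y * ((x + z + y * z / d) * (S / d) ^ 2) = S * ((x + y * z / d) * (S / d) ^ 2)"
      unfolding y(2) using d by (simp add: divide_simps) (simp add: algebra_simps power2_eq_square power3_eq_cube)
    hence "S ^ n * (S * (S * x / d) + y * ((x + z + y * z / d) * (S / d) ^ 2)) =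
       S ^ n * (S * ((x + y * z / d) * (S / d) ^ 2))" by simp
    thus ?thesis by (simp add: algebra_simps)
  qed
  also have "y * z = real (Suc n) * z ^ 2" by (simp add: y_def power2_eq_square)
  finally show ?case unfolding d_def .
qed

section \<open>The number of parking functions\<close>

text \<open>
  The substitution \<open>t = N - W\<close>, where \<open>W = a + s b\<close> and \<open>k = n - s\<close>, gives \<open>t = b + k b\<close> and turns the two
  counts into \<open>a (N - t)\<^sup>n\<^sup>-\<^sup>k\<^sup>-\<^sup>1\<close> and \<open>b t\<^sup>k\<^sup>-\<^sup>1\<close>. The formula for the counts is a premise
  because the lemma serves in the induction that proves it.
\<close>

lemma sum_max_free_eq_abel_sum:
  fixes \<psi> :: "real \<Rightarrow> real" and a b n :: nat and N :: real
  assumes a: "a \<ge> 1" and b: "b \<ge> 1"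
    and card: "\<And>a' m. a' \<ge> 1 \<Longrightarrow> m \<le> n \<Longrightarrow>
      real (card (parking_functions a' b m)) * real (a' + m * b) = real a' * real (a' + m * b) ^ m"
  defines "N \<equiv> real a + (real n + 1) * real b"
  shows "(\<Sum>\<rho>\<in>almost_parking a b n. \<psi> (real (max_free a b \<rho>))) =
    a * b * abel_sum b N n b (\<lambda>t. \<psi> (N - t) / (t * (N - t)))"
proof -
  have "(\<Sum>\<rho>\<in>almost_parking a b n. \<psi> (real (max_free a b \<rho>))) =
    (\<Sum>s\<le>n. real (n choose s) * card (parking_functions a b s) * card (parking_functions b b (n - s)) *
       \<psi> (real (a + s * b)))" by (rule sum_max_free)
  also have "\<dots> = (\<Sum>k\<le>n. real (n choose k) * card (parking_functions a b (n - k)) * card (parking_functions b b k) *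
       \<psi> (real (a + (n - k) * b)))"
    by (rule sum.reindex_bij_witness[of _ "\<lambda>k. n - k" "\<lambda>k. n - k"]) (auto simp flip: binomial_symmetric)
  also have "\<dots> = (\<Sum>k\<le>n. a * b * (real (n choose k) * (b + real k * b) ^ k * (N - (b + real k * b)) ^ (n - k) *
       (\<psi> (N - (b + real k * b)) / ((b + real k * b) * (N - (b + real k * b))))))"
  proof (rule sum.cong)
    fix k assume "k \<in> {..n}"
    hence k: "k \<le> n" by simp
    define t where "t = real (b + k * b)"
    have "b + k * b > 0" using b by simp
    hence t: "t > 0" "real b + real k * real b = t" unfolding t_def by (simp only: of_nat_0_less_iff, simp)
    have Nt: "real (a + (n - k) * b) = N - t"
    proof -
      obtain j where "n = k + j" using k le_Suc_ex by blast
      thus ?thesis by (simp add: N_def t_def algebra_simps)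
    qed
    hence Nt_pos: "N - t > 0" using a by (metis of_nat_0_less_iff add_gr_0 less_le_trans zero_less_one)
    have c1: "real (card (parking_functions a b (n - k))) = a * (N - t) ^ (n - k) / (N - t)"
      using card[OF a, of "n - k"] Nt_pos unfolding Nt by (simp add: field_simps)
    have c2: "real (card (parking_functions b b k)) = b * t ^ k / t"
      using card[OF b k] t unfolding t_def[symmetric] by (simp add: field_simps)
    show "real (n choose k) * card (parking_functions a b (n - k)) * card (parking_functions b b k) *
       \<psi> (real (a + (n - k) * b)) =
      a * b * (real (n choose k) * (b + real k * b) ^ k * (N - (b + real k * b)) ^ (n - k) *
       (\<psi> (N - (b + real k * b)) / ((b + real k * b) * (N - (b + real k * b)))))"
      unfolding c1 c2 Nt t(2) by (simp add: mult_ac)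
  qed simp
  also have "\<dots> = a * b * abel_sum b N n b (\<lambda>t. \<psi> (N - t) / (t * (N - t)))"
    unfolding abel_sum_def sum_distrib_left ..
  finally show ?thesis .
qed

lemma abel_sum_cong:
  assumes "\<And>k. k \<le> n \<Longrightarrow> \<phi> (x + real k * z) = \<phi>' (x + real k * z)"
  shows "abel_sum z S n x \<phi> = abel_sum z S n x \<phi>'"
  unfolding abel_sum_def using assms by (intro sum.cong) auto

text \<open>
  The classical count \<open>a (a + m b)\<^sup>m\<^sup>-\<^sup>1\<close>, multiplied by \<open>a + m b\<close> to cover \<open>m = 0\<close>. Adding up the admissible
  first entries gives an Abel sum of \<open>1 / t\<close>, to which Abel's identity applies.
\<close>

lemma card_parking_functions_times:
  assumes "b \<ge> 1" "a \<ge> 1"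
  shows "real (card (parking_functions a b m)) * real (a + m * b) = real a * real (a + m * b) ^ m"
  using assms(2)
proof (induction m arbitrary: a rule: less_induct)
  case (less m)
  show ?case
  proof (cases m)
    case 0
    have "parking_functions a b 0 = {[]}" by (auto simp: parking_functions_iff)
    thus ?thesis using 0 by simp
  next
    case (Suc n)
    define N where "N = real a + (real n + 1) * real b"
    have N: "real (a + m * b) = N" by (simp add: N_def Suc algebra_simps)
    have b: "real b > 0" using assms(1) by simp
    have "real (card (parking_functions a b (Suc n))) = (\<Sum>\<rho>\<in>almost_parking a b n. real (max_free a b \<rho>))"
      using sum_parking_functions_first[of "\<lambda>_. 1" a b n] by simp
    also have "\<dots> = a * b * abel_sum b N n b (\<lambda>t. (N - t) / (t * (N - t)))"
      unfolding N_def using sum_max_free_eq_abel_sum[OF less.prems assms(1), of n "\<lambda>x. x"] less.IH Suc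
      by (simp add: less_Suc_eq_le)
    also have "abel_sum b N n b (\<lambda>t. (N - t) / (t * (N - t))) = abel_sum b N n b inverse"
    proof (rule abel_sum_cong)
      fix k assume "k \<le> n"
      hence "real k * b \<le> real n * b" by (intro mult_right_mono) auto
      hence "N - (real b + real k * b) \<noteq> 0" using less.prems by (simp add: N_def algebra_simps)
      thus "(N - (real b + real k * b)) / ((real b + real k * b) * (N - (real b + real k * b))) =
        inverse (real b + real k * b)" by (simp add: divide_inverse)
    qed
    also have "a * b * abel_sum b N n b inverse = a * N ^ n"
      using b by (simp add: abel_identity)
    finally show ?thesis unfolding N unfolding Suc by simp
  qed
qed

lemma card_parking_functions:
  assumes "b \<ge> 1" "a \<ge> 1"
  shows "real (card (parking_functions a b (Suc n))) = a * (real a + (real n + 1) * real b) ^ n"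
proof -
  have "real (a + Suc n * b) = real a + (real n + 1) * real b" by (simp add: algebra_simps)
  moreover have "real (a + Suc n * b) > 0" using assms by (simp del: of_nat_add of_nat_mult)
  ultimately show ?thesis using card_parking_functions_times[OF assms, of "Suc n"] by simp
qed

section \<open>The law of the gap\<close>

text \<open>
  The mean of \<open>\<phi>(T)\<close> for the gap \<open>T\<close>, that is, for the law on the points \<open>t = z (k + 1)\<close> with \<open>k \<le> n\<close> whose
  weights are \<open>(n choose k) z t\<^sup>k\<^sup>-\<^sup>1 (N - t)\<^sup>n\<^sup>-\<^sup>k / N\<^sup>n\<close>. Abel's identity says that they add up to \<open>1\<close>.
\<close>

definition gap_mean :: "real \<Rightarrow> real \<Rightarrow> nat \<Rightarrow> (real \<Rightarrow> real) \<Rightarrow> real" where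
  "gap_mean z N n \<phi> = z / N ^ n * abel_sum z N n z (\<lambda>t. \<phi> t / t)"

definition gap_moment :: "real \<Rightarrow> real \<Rightarrow> nat \<Rightarrow> nat \<Rightarrow> real" where
  "gap_moment z N n s = gap_mean z N n (\<lambda>t. (1 - t / N) ^ s)"

lemma gap_mean_add: "gap_mean z N n (\<lambda>t. \<phi> t + \<phi>' t) = gap_mean z N n \<phi> + gap_mean z N n \<phi>'"
  by (simp add: gap_mean_def abel_sum_def add_divide_distrib distrib_left sum.distrib)

lemma gap_mean_cmult: "gap_mean z N n (\<lambda>t. c * \<phi> t) = c * gap_mean z N n \<phi>"
  by (simp add: gap_mean_def abel_sum_def sum_distrib_left mult_ac)

lemma gap_mean_mono:
  assumes "z > 0" "(real n + 1) * z \<le> N"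
    and "\<And>t. 0 < t \<Longrightarrow> t \<le> N \<Longrightarrow> \<phi> t \<le> \<phi>' t"
  shows "gap_mean z N n \<phi> \<le> gap_mean z N n \<phi>'"
proof -
  have N: "N \<ge> 0" using assms by (smt (verit) mult_nonneg_nonneg of_nat_0_le_iff)
  have "abel_sum z N n z (\<lambda>t. \<phi> t / t) \<le> abel_sum z N n z (\<lambda>t. \<phi>' t / t)"
    unfolding abel_sum_def
  proof (rule sum_mono)
    fix k assume "k \<in> {..n}"
    hence "real k * z \<le> real n * z" using assms by (intro mult_right_mono) auto
    moreover have "(real n + 1) * z = z + real n * z" by (simp add: algebra_simps)
    ultimately have t: "0 < z + real k * z" "z + real k * z \<le> N"
      using assms by (simp add: add_pos_nonneg, linarith)
    show "real (n choose k) * (z + real k * z) ^ k * (N - (z + real k * z)) ^ (n - k) *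
        (\<phi> (z + real k * z) / (z + real k * z)) \<le>
      real (n choose k) * (z + real k * z) ^ k * (N - (z + real k * z)) ^ (n - k) *
        (\<phi>' (z + real k * z) / (z + real k * z))"
      using t assms(3)[OF t] by (intro mult_left_mono divide_right_mono mult_nonneg_nonneg) auto
  qed
  thus ?thesis unfolding gap_mean_def using assms N by (intro mult_left_mono) auto
qed

lemma gap_mean_one:
  assumes "z > 0" "N > 0"
  shows "gap_mean z N n (\<lambda>_. 1) = 1"
proof -
  have "abel_sum z N n z (\<lambda>t. 1 / t) = N ^ n / z"
    using abel_identity[of z z N n] assms by (simp add: inverse_eq_divide[abs_def])
  thus ?thesis using assms by (simp add: gap_mean_def)
qed

lemma gap_mean_id:
  assumes "z > 0"
  shows "gap_mean z N n (\<lambda>t. t) = z / N ^ n * abel_sum z N n z (\<lambda>_. 1)"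
proof -
  have "z + real k * z \<noteq> 0" for k using assms by (smt (verit) mult_nonneg_nonneg of_nat_0_le_iff)
  thus ?thesis unfolding gap_mean_def by (subst abel_sum_cong[of n _ _ _ "\<lambda>_. 1"]) auto
qed

lemma gap_mean_square:
  assumes "z > 0"
  shows "gap_mean z N n (\<lambda>t. t ^ 2) = z / N ^ n * abel_sum z N n z (\<lambda>t. t)"
  unfolding gap_mean_def power2_eq_square by simp

text \<open>
  The leading term is the mean of \<open>z\<close> times a Borel variable with parameter \<open>n z / N\<close>; the
  difference of the two bounds is of order \<open>1 / N\<close> when \<open>n z / N\<close> stays away from \<open>1\<close>.
\<close>

lemma gap_mean_id_bounds:
  assumes "z > 0" "real n * z < N"
  shows "gap_mean z N n (\<lambda>t. t) \<le> z * N / (N - real n * z)"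
    and "z * N / (N - real n * z) - real n * z ^ 3 * N / (N - real n * z) ^ 3 \<le> gap_mean z N n (\<lambda>t. t)"
proof -
  have N: "N > 0" using assms by (smt (verit) mult_nonneg_nonneg of_nat_0_le_iff)
  have "z / N ^ n * abel_sum z N n z (\<lambda>_. 1) \<le> z / N ^ n * (N ^ n * (N / (N - real n * z)))"
    using assms N by (intro mult_left_mono abel_sum_one_upper) auto
  thus "gap_mean z N n (\<lambda>t. t) \<le> z * N / (N - real n * z)"
    using assms N by (simp add: gap_mean_id)
  have "z / N ^ n * (N ^ n * (N / (N - real n * z) - real n * z ^ 2 * N / (N - real n * z) ^ 3)) \<le>
      z / N ^ n * abel_sum z N n z (\<lambda>_. 1)"
    using assms N by (intro mult_left_mono abel_sum_one_lower) auto
  thus "z * N / (N - real n * z) - real n * z ^ 3 * N / (N - real n * z) ^ 3 \<le> gap_mean z N n (\<lambda>t. t)"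
    using assms N by (simp add: gap_mean_id power2_eq_square power3_eq_cube algebra_simps)
qed

text \<open>
  When \<open>n z / N\<close> stays away from \<open>1\<close>, this is a uniform bound. The right-hand side
  is the second moment of \<open>z\<close> times a Borel variable with parameter \<open>n z / N\<close>.
\<close>

lemma gap_mean_square_bound:
  assumes "z > 0" "real n * z < N"
  shows "gap_mean z N n (\<lambda>t. t ^ 2) \<le> z ^ 2 * (N / (N - real n * z)) ^ 3"
proof -
  have N: "N > 0" using assms by (smt (verit) mult_nonneg_nonneg of_nat_0_le_iff)
  define d where "d = N - real n * z"
  have d: "d > 0" using assms by (simp add: d_def)
  have "z + real n * z ^ 2 / d = z * (N / d)"
    using d by (simp add: field_simps power2_eq_square) (simp add: d_def algebra_simps)
  moreover have "z / N ^ n * abel_sum z N n z (\<lambda>t. t) \<le>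
      z / N ^ n * (N ^ n * ((z + real n * z ^ 2 / d) * (N / d) ^ 2))"
    unfolding d_def using assms N by (intro mult_left_mono abel_sum_id_upper) auto
  moreover have "z / N ^ n * (N ^ n * (z * (N / d) * (N / d) ^ 2)) = z ^ 2 * (N / d) ^ 3"
    using N by (simp add: power2_eq_square power3_eq_cube)
  ultimately show ?thesis unfolding d_def[symmetric] gap_mean_square[OF assms(1)] by simp
qed

lemma one_minus_power_first_order:
  fixes x :: real
  assumes "0 \<le> x" "x \<le> 1"
  shows "\<bar>(1 - x) ^ s - (1 - real s * x)\<bar> \<le> real s ^ 2 * x ^ 2"
proof (induction s)
  case (Suc s)
  have "(1 - x) ^ Suc s - (1 - real (Suc s) * x) = (1 - x) * ((1 - x) ^ s - (1 - real s * x)) + real s * x ^ 2"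
    by (simp add: algebra_simps power2_eq_square)
  also have "\<bar>\<dots>\<bar> \<le> 1 * (real s ^ 2 * x ^ 2) + real s * x ^ 2"
  proof (intro order_trans[OF abs_triangle_ineq] add_mono)
    show "\<bar>(1 - x) * ((1 - x) ^ s - (1 - real s * x))\<bar> \<le> 1 * (real s ^ 2 * x ^ 2)"
      unfolding abs_mult using assms Suc by (intro mult_mono) auto
  qed simp
  also have "\<dots> \<le> real (Suc s) ^ 2 * x ^ 2" using assms by (simp add: algebra_simps power2_eq_square)
  finally show ?case .
qed simp

lemma one_minus_power_second_order:
  fixes x :: real
  assumes "0 \<le> x" "x \<le> 1"
  shows "\<bar>(1 - x) ^ s - (1 - real s * x + real s * (real s - 1) / 2 * x ^ 2)\<bar> \<le> real s ^ 3 * x ^ 3"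
proof (induction s)
  case (Suc s)
  have "(1 - x) ^ Suc s - (1 - real (Suc s) * x + real (Suc s) * (real (Suc s) - 1) / 2 * x ^ 2) =
    (1 - x) * ((1 - x) ^ s - (1 - real s * x + real s * (real s - 1) / 2 * x ^ 2)) -
    real s * (real s - 1) / 2 * x ^ 3"
    by (simp add: field_simps power2_eq_square power3_eq_cube)
  also have "\<bar>\<dots>\<bar> \<le> 1 * (real s ^ 3 * x ^ 3) + real s ^ 2 * x ^ 3"
  proof (intro order_trans[OF abs_triangle_ineq4] add_mono)
    show "\<bar>(1 - x) * ((1 - x) ^ s - (1 - real s * x + real s * (real s - 1) / 2 * x ^ 2))\<bar>
        \<le> 1 * (real s ^ 3 * x ^ 3)"
      unfolding abs_mult using assms Suc by (intro mult_mono) auto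
    have "\<bar>real s * (real s - 1) / 2\<bar> \<le> real s ^ 2"
      by (cases s) (auto simp: power2_eq_square abs_mult algebra_simps)
    thus "\<bar>real s * (real s - 1) / 2 * x ^ 3\<bar> \<le> real s ^ 2 * x ^ 3"
      unfolding abs_mult[of _ "x ^ 3"] using assms by (intro mult_mono) auto
  qed
  also have "\<dots> \<le> real (Suc s) ^ 3 * x ^ 3"
  proof -
    have "real s ^ 3 + real s ^ 2 \<le> real (Suc s) ^ 3"
      by (simp add: power2_eq_square power3_eq_cube algebra_simps)
    hence "(real s ^ 3 + real s ^ 2) * x ^ 3 \<le> real (Suc s) ^ 3 * x ^ 3"
      using assms by (intro mult_right_mono) auto
    thus ?thesis by (simp add: algebra_simps)
  qed
  finally show ?case .
qed simp

lemma gap_moment_expansion: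
  assumes "z > 0" "(real n + 1) * z \<le> N"
  shows "\<bar>gap_moment z N n s - (1 - real s * gap_mean z N n (\<lambda>t. t) / N)\<bar> \<le>
    real s ^ 2 * gap_mean z N n (\<lambda>t. t ^ 2) / N ^ 2"
proof -
  have N: "N > 0" using assms by (smt (verit) mult_pos_pos of_nat_0_le_iff)
  have pt: "\<bar>(1 - t / N) ^ s - (1 - real s * (t / N))\<bar> \<le> real s ^ 2 * (t / N) ^ 2" if "0 < t" "t \<le> N" for t
    using that N by (intro one_minus_power_first_order) auto
  \<comment> \<open>The two-sided bound as quadratic polynomials in \<open>t\<close>, with the sign \<open>e = 1\<close> or \<open>e = - 1\<close> of the error term.\<close>
  define U where "U e = (\<lambda>t. 1 + (- real s / N) * t + (e * real s ^ 2 / N ^ 2) * t ^ 2)" for e :: real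
  have gmU: "gap_mean z N n (U e) =
      1 - real s * gap_mean z N n (\<lambda>t. t) / N + e * (real s ^ 2 * gap_mean z N n (\<lambda>t. t ^ 2) / N ^ 2)" for e
    unfolding U_def gap_mean_add gap_mean_cmult using gap_mean_one[OF assms(1) N] by simp
  have "gap_moment z N n s \<le> gap_mean z N n (U 1)"
    unfolding gap_moment_def
  proof (rule gap_mean_mono[OF assms])
    fix t assume "0 < t" "t \<le> N"
    from pt[OF this] show "(1 - t / N) ^ s \<le> U 1 t"
      by (simp add: U_def power_divide abs_le_iff)
  qed
  moreover have "gap_mean z N n (U (-1)) \<le> gap_moment z N n s"
    unfolding gap_moment_def
  proof (rule gap_mean_mono[OF assms])
    fix t assume "0 < t" "t \<le> N"
    from pt[OF this] show "U (-1) t \<le> (1 - t / N) ^ s"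
      by (simp add: U_def power_divide abs_le_iff)
  qed
  ultimately show ?thesis unfolding gmU by (simp add: abs_le_iff)
qed

text \<open>
  One of the factors \<open>W\<close> is the weight that defines the law of the gap; the others are \<open>N (1 - T / N)\<close>.
\<close>

lemma sum_max_free_power:
  fixes a b n :: nat and N :: real
  assumes a: "a \<ge> 1" and b: "b \<ge> 1"
  defines "N \<equiv> real a + (real n + 1) * real b"
  shows "(\<Sum>\<rho>\<in>almost_parking a b n. real (max_free a b \<rho>) ^ Suc s) = a * N ^ (n + s) * gap_moment b N n s"
proof -
  have N: "N > 0" using a by (simp add: N_def add_pos_nonneg)
  have "(\<Sum>\<rho>\<in>almost_parking a b n. real (max_free a b \<rho>) ^ Suc s) =
      a * b * abel_sum b N n b (\<lambda>t. (N - t) ^ Suc s / (t * (N - t)))"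
    unfolding N_def by (rule sum_max_free_eq_abel_sum[OF a b card_parking_functions_times[OF b]])
  also have "abel_sum b N n b (\<lambda>t. (N - t) ^ Suc s / (t * (N - t))) =
      abel_sum b N n b (\<lambda>t. N ^ s * ((1 - t / N) ^ s / t))"
  proof (rule abel_sum_cong)
    fix k assume "k \<le> n"
    hence "real k * b \<le> real n * b" by (intro mult_right_mono) auto
    hence "N - (real b + real k * b) \<noteq> 0" using a by (simp add: N_def algebra_simps)
    moreover have "(N - t) ^ s = N ^ s * (1 - t / N) ^ s" for t
      using N by (simp add: right_diff_distrib flip: power_mult_distrib)
    ultimately show "(N - (real b + real k * b)) ^ Suc s / ((real b + real k * b) * (N - (real b + real k * b))) =
        N ^ s * ((1 - (real b + real k * b) / N) ^ s / (real b + real k * b))" by simp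
  qed
  also have "\<dots> = N ^ s * abel_sum b N n b (\<lambda>t. (1 - t / N) ^ s / t)"
    unfolding abel_sum_def sum_distrib_left by (intro sum.cong) (simp_all add: mult_ac)
  finally show ?thesis using N by (simp add: gap_moment_def gap_mean_def power_add)
qed

section \<open>Power sums\<close>

definition power_sum :: "nat \<Rightarrow> nat \<Rightarrow> real" where
  "power_sum p w = (\<Sum>j=1..w. real j ^ p)"

text \<open>
  The first two terms of Euler-Maclaurin summation. One step from \<open>v - 1\<close> to \<open>v\<close> changes the error only by the
  remainders of the Taylor expansions of \<open>(1 - 1 / v)\<^sup>r\<^sup>+\<^sup>3\<close> and \<open>(1 - 1 / v)\<^sup>r\<^sup>+\<^sup>2\<close>, which amount to \<open>O(v\<^sup>r)\<close>.
\<close>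

lemma power_sum_error:
  "\<bar>power_sum (Suc (Suc r)) w - (real w ^ (r + 3) / (real r + 3) + real w ^ (r + 2) / 2)\<bar> \<le>
     ((real r + 3) ^ 2 + (real r + 2) ^ 2) * real w ^ Suc r"
proof (induction w)
  case 0
  show ?case by (simp add: power_sum_def power_0_left)
next
  case (Suc w)
  define v where "v = real (Suc w)"
  define x where "x = 1 / v"
  have v: "v \<ge> 1" "real w = v * (1 - x)" by (auto simp: v_def x_def field_simps)
  have x: "0 \<le> x" "x \<le> 1" "v * x = 1" using v by (auto simp: x_def)
  define e2 where "e2 = (1 - x) ^ (r + 3) - (1 - (real r + 3) * x + (real r + 3) * (real r + 2) / 2 * x ^ 2)"
  define e1 where "e1 = (1 - x) ^ (r + 2) - (1 - (real r + 2) * x)"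
  define E where "E u = real u ^ (r + 3) / (real r + 3) + real u ^ (r + 2) / 2" for u
  have e2: "\<bar>e2\<bar> \<le> (real r + 3) ^ 3 * x ^ 3"
    using one_minus_power_second_order[OF x(1,2), of "r + 3"] unfolding e2_def by (simp add: algebra_simps)
  have e1: "\<bar>e1\<bar> \<le> (real r + 2) ^ 2 * x ^ 2"
    using one_minus_power_first_order[OF x(1,2), of "r + 2"] unfolding e1_def by (simp add: algebra_simps)
  have step: "v ^ (r + 2) - (E (Suc w) - E w) = v ^ (r + 3) * e2 / (real r + 3) + v ^ (r + 2) * e1 / 2"
  proof -
    have "E w = v ^ (r + 3) * (1 - x) ^ (r + 3) / (real r + 3) + v ^ (r + 2) * (1 - x) ^ (r + 2) / 2"
      unfolding E_def v(2) power_mult_distrib by simp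
    also have "(1 - x) ^ (r + 3) = e2 + (1 - (real r + 3) * x + (real r + 3) * (real r + 2) / 2 * x ^ 2)"
      by (simp add: e2_def)
    also have "(1 - x) ^ (r + 2) = e1 + (1 - (real r + 2) * x)" by (simp add: e1_def)
    also have "v ^ (r + 3) * (e2 + (1 - (real r + 3) * x + (real r + 3) * (real r + 2) / 2 * x ^ 2)) / (real r + 3) =
       v ^ (r + 3) * e2 / (real r + 3) + v ^ (r + 3) / (real r + 3) - v ^ (r + 2) * (v * x) +
       (real r + 2) / 2 * v ^ (r + 1) * (v * x) ^ 2"
    proof -
      have "(e2 + (1 - R * x + R * (real r + 2) / 2 * x ^ 2)) / R = e2 / R + 1 / R - x + (real r + 2) / 2 * x ^ 2"
        if "R \<noteq> 0" for R using that by (simp add: field_simps)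
      from this[of "real r + 3"] have "v ^ (r + 3) * ((e2 + (1 - (real r + 3) * x + (real r + 3) * (real r + 2) / 2 * x ^ 2)) / (real r + 3)) =
         v ^ (r + 3) * (e2 / (real r + 3) + 1 / (real r + 3) - x + (real r + 2) / 2 * x ^ 2)" by simp
      thus ?thesis by (simp add: algebra_simps power_add power2_eq_square power3_eq_cube)
    qed
    also have "v ^ (r + 2) * (e1 + (1 - (real r + 2) * x)) / 2 =
        v ^ (r + 2) * e1 / 2 + v ^ (r + 2) / 2 - (real r + 2) / 2 * v ^ (r + 1) * (v * x)"
      by (simp add: field_simps power_add power2_eq_square)
    finally show ?thesis unfolding x(3) E_def v_def[symmetric] by simp
  qed
  have v3: "v ^ (r + 3) * x ^ 3 = v ^ r" "v ^ (r + 2) * x ^ 2 = v ^ r"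
  proof -
    have "v ^ (r + i) * x ^ i = v ^ r * (v * x) ^ i" for i by (simp add: power_add power_mult_distrib)
    hence "v ^ (r + i) * x ^ i = v ^ r" for i unfolding x(3) by simp
    thus "v ^ (r + 3) * x ^ 3 = v ^ r" "v ^ (r + 2) * x ^ 2 = v ^ r" by blast+
  qed
  have b1: "\<bar>v ^ (r + 3) * e2 / (real r + 3)\<bar> \<le> (real r + 3) ^ 2 * v ^ r"
  proof -
    have "\<bar>v ^ (r + 3) * e2 / (real r + 3)\<bar> = v ^ (r + 3) * \<bar>e2\<bar> / (real r + 3)"
      using v by (simp add: abs_mult)
    also have "\<dots> \<le> v ^ (r + 3) * ((real r + 3) ^ 3 * x ^ 3) / (real r + 3)"
      using v e2 by (intro divide_right_mono mult_left_mono) auto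
    also have "\<dots> = (real r + 3) ^ 3 / (real r + 3) * (v ^ (r + 3) * x ^ 3)" by simp
    also have "(real r + 3) ^ 3 / (real r + 3) = (real r + 3) ^ 2"
      by (simp add: power2_eq_square power3_eq_cube)
    finally show ?thesis unfolding v3 .
  qed
  have b2: "\<bar>v ^ (r + 2) * e1 / 2\<bar> \<le> (real r + 2) ^ 2 * v ^ r"
  proof -
    have "\<bar>v ^ (r + 2) * e1 / 2\<bar> \<le> v ^ (r + 2) * \<bar>e1\<bar>" using v by (simp add: abs_mult)
    also have "\<dots> \<le> v ^ (r + 2) * ((real r + 2) ^ 2 * x ^ 2)"
      using v e1 by (intro mult_left_mono) auto
    also have "\<dots> = (real r + 2) ^ 2 * (v ^ (r + 2) * x ^ 2)" by simp
    finally show ?thesis unfolding v3 .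
  qed
  define C where "C = (real r + 3) ^ 2 + (real r + 2) ^ 2"
  have C: "C \<ge> 0" by (simp add: C_def)
  have "power_sum (Suc (Suc r)) (Suc w) - E (Suc w) =
      (power_sum (Suc (Suc r)) w - E w) + (v ^ (r + 2) - (E (Suc w) - E w))"
    by (simp add: power_sum_def v_def)
  also have "\<bar>\<dots>\<bar> \<le> C * real w ^ Suc r + C * v ^ r"
    unfolding step
  proof (rule order_trans[OF abs_triangle_ineq add_mono])
    show "\<bar>power_sum (Suc (Suc r)) w - E w\<bar> \<le> C * real w ^ Suc r"
      using Suc unfolding E_def C_def .
    show "\<bar>v ^ (r + 3) * e2 / (real r + 3) + v ^ (r + 2) * e1 / 2\<bar> \<le> C * v ^ r"
      using b1 b2 unfolding C_def distrib_right by linarith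
  qed
  also have "\<dots> \<le> C * (real w * v ^ r) + C * v ^ r"
    using C by (auto intro!: mult_left_mono power_mono simp: v_def)
  also have "\<dots> = C * v ^ Suc r" by (simp add: v_def algebra_simps)
  finally show ?case unfolding E_def C_def v_def .
qed

text \<open>
  The factor \<open>w\<close> in the bound is kept separate from the powers of \<open>N\<close>, since it becomes the weight \<open>W\<close> of the gap
  law when the bound is summed over sequences. For \<open>p = 1\<close> the approximation is exact.
\<close>

lemma power_sum_approx:
  assumes "p \<ge> 1"
  shows "\<exists>C\<ge>0. \<forall>w. \<forall>N::real. real w \<le> N \<longrightarrow> N > 0 \<longrightarrow>
    \<bar>power_sum p w - (real w ^ Suc p / (real p + 1) + real w ^ p / 2)\<bar> \<le> C * real w * N ^ p / N ^ 2"
proof (cases "p = 1")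
  case True
  have "power_sum 1 w = real w ^ 2 / 2 + real w / 2" for w
    by (induction w) (auto simp: power_sum_def power2_eq_square field_simps)
  thus ?thesis unfolding True by (intro exI[of _ 0]) (auto simp: power2_eq_square)
next
  case False
  with assms obtain r where p: "p = Suc (Suc r)" by (metis One_nat_def Suc_le_D not0_implies_Suc)
  define C where "C = (real r + 3) ^ 2 + (real r + 2) ^ 2"
  have "\<bar>power_sum p w - (real w ^ Suc p / (real p + 1) + real w ^ p / 2)\<bar> \<le> C * real w * N ^ p / N ^ 2"
    if "real w \<le> N" "N > 0" for w N
  proof -
    have "\<bar>power_sum p w - (real w ^ Suc p / (real p + 1) + real w ^ p / 2)\<bar> \<le> C * real w ^ Suc r"
      using power_sum_error[of r w] unfolding p C_def by (simp add: add.commute numeral_3_eq_3)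
    also have "\<dots> \<le> C * (real w * N ^ r)"
      using that by (auto simp: C_def intro!: mult_left_mono power_mono)
    also have "\<dots> = C * real w * N ^ p / N ^ 2" using that by (simp add: p power2_eq_square)
    finally show ?thesis .
  qed
  moreover have "C \<ge> 0" by (simp add: C_def)
  ultimately show ?thesis by blast
qed

section \<open>Expectations in terms of gap moments\<close>

lemma pf_expectation_eq:
  assumes "a \<ge> 1" "b \<ge> 1"
  shows "pf_expectation a b (Suc n) X =
    (\<Sum>\<pi>\<in>parking_functions a b (Suc n). X \<pi>) / (a * (real a + (real n + 1) * real b) ^ n)"
proof -
  have "real a + (real n + 1) * real b > 0" using assms by (simp add: add_pos_nonneg)
  hence "real (card (parking_functions a b (Suc n))) > 0"
    using assms by (simp add: card_parking_functions)
  hence "parking_functions a b (Suc n) \<noteq> {}" by auto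
  thus ?thesis unfolding pf_expectation_def
    by (simp only: integral_pmf_of_set[OF _ finite_parking_functions] card_parking_functions[OF assms(2,1)]
        not_False_eq_True)
qed

lemma max_free_le:
  assumes "\<rho> \<in> almost_parking a b n"
  shows "max_free a b \<rho> \<le> a + n * b"
  using assms tight_index_le_length[of a b \<rho>] by (simp add: max_free_def almost_parking_def)

text \<open>
  The number of parking functions is the total of the weights \<open>W\<close>. Dividing by it turns the sums of \<open>W\<^sup>p\<^sup>+\<^sup>1\<close> and
  \<open>W\<^sup>p\<close> into gap moments, and the sum of the error bounds, which are linear in \<open>W\<close>, into \<open>C / N\<^sup>2\<close>.
\<close>

lemma expectation_first_approx:
  assumes p: "p \<ge> 1" and b: "b \<ge> 1"
  shows "\<exists>C\<ge>0. \<forall>a n. \<forall>N::real. a \<ge> 1 \<longrightarrow> N = real a + (real n + 1) * real b \<longrightarrow>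
    \<bar>pf_expectation a b (Suc n) (\<lambda>\<pi>. real (\<pi> ! 0) ^ p) / N ^ p -
       (gap_moment b N n p / (real p + 1) + gap_moment b N n (p - 1) / (2 * N))\<bar> \<le> C / N ^ 2"
proof -
  obtain C where C: "C \<ge> 0" and approx: "\<And>w N. real w \<le> N \<Longrightarrow> N > 0 \<Longrightarrow>
    \<bar>power_sum p w - (real w ^ Suc p / (real p + 1) + real w ^ p / 2)\<bar> \<le> C * real w * N ^ p / N ^ 2"
    using power_sum_approx[OF p] by metis
  have "\<bar>pf_expectation a b (Suc n) (\<lambda>\<pi>. real (\<pi> ! 0) ^ p) / N ^ p -
       (gap_moment b N n p / (real p + 1) + gap_moment b N n (p - 1) / (2 * N))\<bar> \<le> C / N ^ 2"
    if a: "a \<ge> 1" and N_eq: "N = real a + (real n + 1) * real b" for a n and N :: real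
  proof -
    define A where "A = almost_parking a b n"
    define W where "W \<rho> = max_free a b \<rho>" for \<rho>
    have N: "N > 0" using a by (simp add: N_eq add_pos_nonneg)
    have W_le: "real (W \<rho>) \<le> N" if "\<rho> \<in> A" for \<rho>
    proof -
      have "real (W \<rho>) \<le> real (a + n * b)"
        using max_free_le that unfolding A_def W_def of_nat_le_iff by blast
      also have "\<dots> \<le> N" by (simp add: N_eq algebra_simps)
      finally show ?thesis .
    qed
    have pow: "(\<Sum>\<rho>\<in>A. real (W \<rho>) ^ Suc s) = a * N ^ (n + s) * gap_moment b N n s" for s
      unfolding A_def W_def N_eq by (rule sum_max_free_power[OF a b])
    define S where "S = (\<Sum>\<rho>\<in>A. power_sum p (W \<rho>))"
    have E: "pf_expectation a b (Suc n) (\<lambda>\<pi>. real (\<pi> ! 0) ^ p) = S / (a * N ^ n)"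
      unfolding pf_expectation_eq[OF a b] S_def A_def W_def N_eq power_sum_def
      sum_parking_functions_first[of "\<lambda>x. real x ^ p", symmetric] ..
    obtain r where r: "p = Suc r" using p by (cases p) auto
    have "\<bar>S - (a * N ^ (n + p) * gap_moment b N n p / (real p + 1) + a * N ^ (n + (p - 1)) * gap_moment b N n (p - 1) / 2)\<bar>
      = \<bar>\<Sum>\<rho>\<in>A. power_sum p (W \<rho>) - (real (W \<rho>) ^ Suc p / (real p + 1) + real (W \<rho>) ^ p / 2)\<bar>"
      unfolding sum_subtractf sum.distrib S_def sum_divide_distrib[symmetric] pow[symmetric] r by simp
    also have "\<dots> \<le> (\<Sum>\<rho>\<in>A. C * real (W \<rho>) * N ^ p / N ^ 2)"
      using approx[OF W_le N] by (intro order_trans[OF sum_abs] sum_mono)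
    also have "\<dots> = C * N ^ p / N ^ 2 * (\<Sum>\<rho>\<in>A. real (W \<rho>) ^ Suc 0)"
      unfolding sum_distrib_left by (intro sum.cong) auto
    also have "\<dots> = C * N ^ p / N ^ 2 * (a * N ^ n)"
    proof -
      have "gap_moment b N n 0 = 1" unfolding gap_moment_def using gap_mean_one[of b N n] b N by simp
      thus ?thesis unfolding pow by simp
    qed
    finally have main: "\<bar>S - (a * N ^ (n + p) * gap_moment b N n p / (real p + 1) +
        a * N ^ (n + (p - 1)) * gap_moment b N n (p - 1) / 2)\<bar> \<le> C * N ^ p / N ^ 2 * (a * N ^ n)" .
    define D where "D = a * N ^ n * N ^ p"
    have D: "D > 0" using a N by (simp add: D_def)
    have "S / (a * N ^ n) / N ^ p - (gap_moment b N n p / (real p + 1) + gap_moment b N n (p - 1) / (2 * N)) =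
      (S - (a * N ^ (n + p) * gap_moment b N n p / (real p + 1) + a * N ^ (n + (p - 1)) * gap_moment b N n (p - 1) / 2)) / D"
    proof -
      have e1: "a * N ^ (n + p) * gap_moment b N n p / (real p + 1) / D = gap_moment b N n p / (real p + 1)"
        using N a by (simp add: D_def power_add)
      have e2: "a * N ^ (n + (p - 1)) * gap_moment b N n (p - 1) / 2 / D = gap_moment b N n (p - 1) / (2 * N)"
        using a N by (simp add: D_def power_add r)
      show ?thesis unfolding diff_divide_distrib add_divide_distrib e1 e2 by (simp add: D_def)
    qed
    hence "\<bar>S / (a * N ^ n) / N ^ p - (gap_moment b N n p / (real p + 1) + gap_moment b N n (p - 1) / (2 * N))\<bar> =
      \<bar>S - (a * N ^ (n + p) * gap_moment b N n p / (real p + 1) + a * N ^ (n + (p - 1)) * gap_moment b N n (p - 1) / 2)\<bar> / D"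
      using D by simp
    also have "\<dots> \<le> C * N ^ p / N ^ 2 * (a * N ^ n) / D"
      using main D by (intro divide_right_mono) auto
    also have "\<dots> = C / N ^ 2" using a N by (simp add: D_def)
    finally show ?thesis unfolding E .
  qed
  thus ?thesis using C by blast
qed

lemma power_sum_le:
  assumes "real w \<le> N"
  shows "power_sum p w \<le> real w * N ^ p"
proof -
  have "power_sum p w \<le> (\<Sum>j=1..w. N ^ p)"
    unfolding power_sum_def using assms by (intro sum_mono power_mono) auto
  thus ?thesis by simp
qed

lemma power_sum_diff_bounds:
  assumes "v \<le> w" "real w \<le> N"
  shows "0 \<le> power_sum p w - power_sum p v"
    and "power_sum p w - power_sum p v \<le> (real w - real v) * N ^ p"
proof -
  have "{1..w} = {1..v} \<union> {v<..w}" "{1..v} \<inter> {v<..w} = {}" using assms by auto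
  hence eq: "power_sum p w - power_sum p v = (\<Sum>j\<in>{v<..w}. real j ^ p)"
    unfolding power_sum_def by (simp add: sum.union_disjoint)
  show "0 \<le> power_sum p w - power_sum p v" unfolding eq by (intro sum_nonneg) auto
  have "(\<Sum>j\<in>{v<..w}. real j ^ p) \<le> (\<Sum>j\<in>{v<..w}. N ^ p)"
    using assms by (intro sum_mono power_mono) auto
  thus "power_sum p w - power_sum p v \<le> (real w - real v) * N ^ p"
    unfolding eq using assms by (simp add: of_nat_diff)
qed

lemma power_sum_mult_approx:
  assumes p: "p \<ge> 1" and q: "q \<ge> 1"
  shows "\<exists>C\<ge>0. \<forall>w. \<forall>N::real. real w \<le> N \<longrightarrow> N \<ge> 1 \<longrightarrow>
    \<bar>power_sum p w * power_sum q w -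
      (real w ^ (p + q + 2) + real (p + q + 2) / 2 * real w ^ (p + q + 1)) / ((real p + 1) * (real q + 1))\<bar>
    \<le> C * real w * N ^ (p + q + 1) / N ^ 2"
proof -
  obtain C1 where C1: "C1 \<ge> 0" and approx1: "\<And>w N. real w \<le> N \<Longrightarrow> N > 0 \<Longrightarrow>
    \<bar>power_sum p w - (real w ^ Suc p / (real p + 1) + real w ^ p / 2)\<bar> \<le> C1 * real w * N ^ p / N ^ 2"
    using power_sum_approx[OF p] by metis
  obtain C2 where C2: "C2 \<ge> 0" and approx2: "\<And>w N. real w \<le> N \<Longrightarrow> N > 0 \<Longrightarrow>
    \<bar>power_sum q w - (real w ^ Suc q / (real q + 1) + real w ^ q / 2)\<bar> \<le> C2 * real w * N ^ q / N ^ 2"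
    using power_sum_approx[OF q] by metis
  define C where "C = 1 + C1 + 2 * C2"
  have "\<bar>power_sum p w * power_sum q w -
      (real w ^ (p + q + 2) + real (p + q + 2) / 2 * real w ^ (p + q + 1)) / ((real p + 1) * (real q + 1))\<bar>
    \<le> C * real w * N ^ (p + q + 1) / N ^ 2" if w: "real w \<le> N" and N: "N \<ge> 1" for w and N :: real
  proof -
    define y where "y = real w"
    have y: "0 \<le> y" "y \<le> N" using w by (auto simp: y_def)
    define T where "T = y * N ^ (p + q + 1) / N ^ 2"
    define A B A' B' e e' where "A = y ^ Suc p / (real p + 1)" "B = y ^ p / 2"
      "A' = y ^ Suc q / (real q + 1)" "B' = y ^ q / 2" "e = power_sum p w - (A + B)" "e' = power_sum q w - (A' + B')"
    note defs = this
    have N0: "N > 0" using N by simp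
    have e: "\<bar>e\<bar> \<le> C1 * y * N ^ p / N ^ 2" using approx1[OF w N0] by (simp add: defs y_def)
    have e': "\<bar>e'\<bar> \<le> C2 * y * N ^ q / N ^ 2" using approx2[OF w N0] by (simp add: defs y_def)
    have "power_sum p w * power_sum q w = A * A' + (A * B' + B * A') + (B * B' + e * power_sum q w + (A + B) * e')"
      by (simp add: defs algebra_simps)
    moreover have "A * A' + (A * B' + B * A') =
       (y ^ (p + q + 2) + real (p + q + 2) / 2 * y ^ (p + q + 1)) / ((real p + 1) * (real q + 1))"
      by (simp add: defs power_add divide_simps) (simp add: algebra_simps power2_eq_square)
    ultimately have eq: "power_sum p w * power_sum q w -
       (y ^ (p + q + 2) + real (p + q + 2) / 2 * y ^ (p + q + 1)) / ((real p + 1) * (real q + 1)) =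
       B * B' + e * power_sum q w + (A + B) * e'" by simp
    have b1: "\<bar>B * B'\<bar> \<le> T"
    proof -
      obtain r where r: "p + q = Suc r" using p by (cases "p + q") auto
      have "\<bar>B * B'\<bar> = y ^ (p + q) / 4" using y by (simp add: defs power_add)
      also have "\<dots> \<le> y * y ^ r" using y unfolding r by simp
      also have "\<dots> \<le> y * N ^ r" using y by (intro mult_left_mono power_mono) auto
      also have "\<dots> = T" using N0 by (simp add: T_def r power2_eq_square)
      finally show ?thesis .
    qed
    have b2: "\<bar>e * power_sum q w\<bar> \<le> C1 * T"
    proof -
      have "0 \<le> power_sum q w" unfolding power_sum_def by (intro sum_nonneg) auto
      moreover have "power_sum q w \<le> N * N ^ q"
        using power_sum_le[OF w, of q] w N0 by (meson mult_right_mono order_trans zero_le_power less_imp_le)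
      ultimately have "\<bar>e * power_sum q w\<bar> \<le> (C1 * y * N ^ p / N ^ 2) * (N * N ^ q)"
        unfolding abs_mult using e by (intro mult_mono) auto
      thus ?thesis by (simp add: T_def power_add mult_ac)
    qed
    have b3: "\<bar>(A + B) * e'\<bar> \<le> 2 * (C2 * T)"
    proof -
      have "A \<le> y ^ Suc p"
        using y unfolding defs by (intro divide_le_eq[THEN iffD2]) (auto simp: mult_left_le algebra_simps)
      also have "\<dots> \<le> N ^ Suc p" using y by (intro power_mono) auto
      finally have "A \<le> N ^ Suc p" .
      moreover have "B \<le> N ^ Suc p"
      proof -
        have "B \<le> y ^ p" using y by (simp add: defs)
        also have "\<dots> \<le> N ^ p" using y by (intro power_mono) auto
        also have "\<dots> \<le> N ^ Suc p" using N by (intro power_increasing) auto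
        finally show ?thesis .
      qed
      moreover have "A \<ge> 0" "B \<ge> 0" using y by (auto simp: defs)
      ultimately have "\<bar>(A + B) * e'\<bar> \<le> (2 * N ^ Suc p) * (C2 * y * N ^ q / N ^ 2)"
        unfolding abs_mult using e' by (intro mult_mono) auto
      thus ?thesis by (simp add: T_def power_add mult_ac)
    qed
    have "\<bar>B * B' + e * power_sum q w + (A + B) * e'\<bar> \<le> C * T"
      using b1 b2 b3 unfolding C_def distrib_right by linarith
    thus ?thesis unfolding eq[symmetric] unfolding T_def y_def by (simp add: mult.assoc)
  qed
  moreover have "C \<ge> 0" using C1 C2 by (simp add: C_def)
  ultimately show ?thesis by blast
qed

text \<open>
  The error has two parts: the approximation of the power sums, and the missing corner. The latter is measured by the
  mean of \<open>(W - V)\<^sup>2\<close>, whose exact value comes from counting all parking functions with both powers replaced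
  by \<open>1\<close>.
\<close>

lemma expectation_first_two_approx:
  assumes p: "p \<ge> 1" and q: "q \<ge> 1" and b: "b \<ge> 1"
  shows "\<exists>C\<ge>0. \<forall>a n. \<forall>N::real. a \<ge> 1 \<longrightarrow> N = real a + (real n + 2) * real b \<longrightarrow>
    \<bar>pf_expectation a b (Suc (Suc n)) (\<lambda>\<pi>. real (\<pi> ! 0) ^ p * real (\<pi> ! 1) ^ q) / N ^ (p + q) -
       (1 + b / a) * (gap_moment b N n (p + q + 1) + real (p + q + 2) / (2 * N) * gap_moment b N n (p + q))
         / ((real p + 1) * (real q + 1))\<bar>
      \<le> (1 + b / a) * C / N ^ 2 + ((1 + b / a) * gap_moment b N n 1 - 1)"
proof -
  obtain C where C: "C \<ge> 0" and approx: "\<And>w N. real w \<le> N \<Longrightarrow> N \<ge> 1 \<Longrightarrow>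
    \<bar>power_sum p w * power_sum q w -
      (real w ^ (p + q + 2) + real (p + q + 2) / 2 * real w ^ (p + q + 1)) / ((real p + 1) * (real q + 1))\<bar>
    \<le> C * real w * N ^ (p + q + 1) / N ^ 2"
    using power_sum_mult_approx[OF p q] by metis
  have "\<bar>pf_expectation a b (Suc (Suc n)) (\<lambda>\<pi>. real (\<pi> ! 0) ^ p * real (\<pi> ! 1) ^ q) / N ^ (p + q) -
       (1 + b / a) * (gap_moment b N n (p + q + 1) + real (p + q + 2) / (2 * N) * gap_moment b N n (p + q))
         / ((real p + 1) * (real q + 1))\<bar>
      \<le> (1 + b / a) * C / N ^ 2 + ((1 + b / a) * gap_moment b N n 1 - 1)"
    if a: "a \<ge> 1" and N_eq: "N = real a + (real n + 2) * real b" for a n and N :: real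
  proof -
    define A where "A = almost_parking (a + b) b n"
    define W where "W \<rho> = max_free (a + b) b \<rho>" for \<rho>
    define V where "V \<rho> = max_free a b \<rho>" for \<rho>
    have ab: "a + b \<ge> 1" using a by simp
    have N_eq1: "N = real (a + b) + (real n + 1) * real b" by (simp add: N_eq algebra_simps)
    have N_eq2: "N = real a + (real (Suc n) + 1) * real b" by (simp add: N_eq algebra_simps)
    have N1: "N \<ge> 1" using a by (simp add: N_eq add_increasing2)
    hence N: "N > 0" by simp
    have W_le: "real (W \<rho>) \<le> N" if "\<rho> \<in> A" for \<rho>
    proof -
      have "real (W \<rho>) \<le> real (a + b + n * b)"
        using max_free_le that unfolding A_def W_def of_nat_le_iff by blast
      also have "\<dots> \<le> N" by (simp add: N_eq algebra_simps)
      finally show ?thesis .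
    qed
    have VW: "V \<rho> \<le> W \<rho>" for \<rho> unfolding V_def W_def by (rule max_free_mono)
    have pow: "(\<Sum>\<rho>\<in>A. real (W \<rho>) ^ Suc s) = real (a + b) * N ^ (n + s) * gap_moment b N n s" for s
      unfolding A_def W_def N_eq1 by (rule sum_max_free_power[OF ab b])
    define D where "D = real a * N ^ Suc n"
    have D: "D > 0" using a N by (simp add: D_def)
    have ratio: "real (a + b) * N ^ Suc n = (1 + b / a) * D" using a by (simp add: D_def field_simps)
    have gap0: "gap_moment b N n 0 = 1" unfolding gap_moment_def using gap_mean_one[of b N n] b N by simp
    define S where "S = (\<Sum>\<rho>\<in>A. power_sum p (W \<rho>) * power_sum q (W \<rho>))"
    define \<Delta> where "\<Delta> = (\<Sum>\<rho>\<in>A. (power_sum p (W \<rho>) - power_sum p (V \<rho>)) * (power_sum q (W \<rho>) - power_sum q (V \<rho>)))"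
    have E: "pf_expectation a b (Suc (Suc n)) (\<lambda>\<pi>. real (\<pi> ! 0) ^ p * real (\<pi> ! 1) ^ q) = (S - \<Delta>) / D"
      unfolding pf_expectation_eq[OF a b] S_def \<Delta>_def A_def W_def V_def D_def N_eq2 power_sum_def
        sum_parking_functions_first_two[of "\<lambda>x. real x ^ p" "\<lambda>x. real x ^ q"] sum_subtractf ..
    \<comment> \<open>The count of all parking functions is the sum of \<open>W\<^sup>2 - (W - V)\<^sup>2\<close>.\<close>
    have gaps: "(\<Sum>\<rho>\<in>A. (real (W \<rho>) - real (V \<rho>)) ^ 2) = D * ((1 + b / a) * gap_moment b N n 1 - 1)"
    proof -
      have "D = real (card (parking_functions a b (Suc (Suc n))))"
        unfolding card_parking_functions[OF b a] D_def N_eq2 ..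
      also have "\<dots> = (\<Sum>\<rho>\<in>A. real (W \<rho>) ^ Suc 1 - (real (W \<rho>) - real (V \<rho>)) ^ 2)"
        using sum_parking_functions_first_two[of "\<lambda>_. 1" "\<lambda>_. 1" a b n]
        unfolding A_def W_def V_def by (simp add: power2_eq_square)
      also have "\<dots> = real (a + b) * N ^ Suc n * gap_moment b N n 1 - (\<Sum>\<rho>\<in>A. (real (W \<rho>) - real (V \<rho>)) ^ 2)"
        unfolding sum_subtractf pow by simp
      finally show ?thesis unfolding ratio by (simp add: algebra_simps)
    qed
    have \<Delta>: "0 \<le> \<Delta>" "\<Delta> \<le> N ^ (p + q) * (D * ((1 + b / a) * gap_moment b N n 1 - 1))"
    proof -
      show "0 \<le> \<Delta>" unfolding \<Delta>_def
        using power_sum_diff_bounds(1)[OF VW W_le] by (intro sum_nonneg mult_nonneg_nonneg)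
      have "\<Delta> \<le> (\<Sum>\<rho>\<in>A. ((real (W \<rho>) - real (V \<rho>)) * N ^ p) * ((real (W \<rho>) - real (V \<rho>)) * N ^ q))"
        unfolding \<Delta>_def
      proof (rule sum_mono)
        fix \<rho> assume \<rho>: "\<rho> \<in> A"
        show "(power_sum p (W \<rho>) - power_sum p (V \<rho>)) * (power_sum q (W \<rho>) - power_sum q (V \<rho>)) \<le>
          ((real (W \<rho>) - real (V \<rho>)) * N ^ p) * ((real (W \<rho>) - real (V \<rho>)) * N ^ q)"
          using power_sum_diff_bounds[OF VW W_le[OF \<rho>]] VW[of \<rho>] N by (intro mult_mono) auto
      qed
      also have "\<dots> = N ^ (p + q) * (\<Sum>\<rho>\<in>A. (real (W \<rho>) - real (V \<rho>)) ^ 2)"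
        unfolding sum_distrib_left by (intro sum.cong) (simp_all add: power_add power2_eq_square mult_ac)
      finally show "\<Delta> \<le> N ^ (p + q) * (D * ((1 + b / a) * gap_moment b N n 1 - 1))" unfolding gaps .
    qed
    define M where "M = (1 + b / a) * (gap_moment b N n (p + q + 1) + real (p + q + 2) / (2 * N) * gap_moment b N n (p + q))
         / ((real p + 1) * (real q + 1))"
    have "\<bar>S - N ^ (p + q) * D * M\<bar> = \<bar>\<Sum>\<rho>\<in>A. power_sum p (W \<rho>) * power_sum q (W \<rho>) -
      (real (W \<rho>) ^ (p + q + 2) + real (p + q + 2) / 2 * real (W \<rho>) ^ (p + q + 1)) / ((real p + 1) * (real q + 1))\<bar>"
    proof -
      have "(\<Sum>\<rho>\<in>A. (real (W \<rho>) ^ (p + q + 2) + real (p + q + 2) / 2 * real (W \<rho>) ^ (p + q + 1)) / ((real p + 1) * (real q + 1))) =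
        ((\<Sum>\<rho>\<in>A. real (W \<rho>) ^ Suc (p + q + 1)) + real (p + q + 2) / 2 * (\<Sum>\<rho>\<in>A. real (W \<rho>) ^ Suc (p + q))) / ((real p + 1) * (real q + 1))"
        unfolding sum_divide_distrib[symmetric] sum.distrib sum_distrib_left[symmetric] by simp
      also have "(\<Sum>\<rho>\<in>A. real (W \<rho>) ^ Suc (p + q + 1)) = N ^ (p + q) * D * ((1 + b / a) * gap_moment b N n (p + q + 1))"
      proof -
        have "real (a + b) * N ^ (n + (p + q + 1)) = N ^ (p + q) * (real (a + b) * N ^ Suc n)"
          by (simp add: power_add mult_ac)
        thus ?thesis unfolding pow ratio by simp
      qed
      also have "(\<Sum>\<rho>\<in>A. real (W \<rho>) ^ Suc (p + q)) = N ^ (p + q) * D * ((1 + b / a) * gap_moment b N n (p + q)) / N"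
      proof -
        have "real (a + b) * N ^ (n + (p + q)) = N ^ (p + q) * (real (a + b) * N ^ Suc n) / N"
          using N by (simp add: power_add mult_ac)
        thus ?thesis unfolding pow ratio by simp
      qed
      finally have "(\<Sum>\<rho>\<in>A. (real (W \<rho>) ^ (p + q + 2) + real (p + q + 2) / 2 * real (W \<rho>) ^ (p + q + 1)) / ((real p + 1) * (real q + 1))) =
         N ^ (p + q) * D * M"
        unfolding M_def using N by (simp add: algebra_simps add_divide_distrib)
      thus ?thesis unfolding S_def sum_subtractf by simp
    qed
    also have "\<dots> \<le> (\<Sum>\<rho>\<in>A. C * real (W \<rho>) * N ^ (p + q + 1) / N ^ 2)"
      using approx[OF W_le N1] by (intro order_trans[OF sum_abs] sum_mono)
    also have "\<dots> = C * N ^ (p + q + 1) / N ^ 2 * (\<Sum>\<rho>\<in>A. real (W \<rho>) ^ Suc 0)"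
      unfolding sum_distrib_left by (intro sum.cong) auto
    also have "\<dots> = C * N ^ (p + q) / N ^ 2 * (real (a + b) * N ^ Suc n)"
      unfolding pow gap0 by simp
    also have "\<dots> = N ^ (p + q) * D * ((1 + b / a) * C / N ^ 2)" unfolding ratio by simp
    finally have main: "\<bar>S - N ^ (p + q) * D * M\<bar> \<le> N ^ (p + q) * D * ((1 + b / a) * C / N ^ 2)" .
    define K where "K = N ^ (p + q) * D"
    have K: "K > 0" using N D by (simp add: K_def)
    have "(S - \<Delta>) / D / N ^ (p + q) - M = (S - K * M - \<Delta>) / K"
    proof -
      have "(S - \<Delta>) / D / N ^ (p + q) = (S - \<Delta>) / K" by (simp add: K_def mult.commute)
      thus ?thesis using K by (simp add: diff_divide_distrib)
    qed
    hence "\<bar>(S - \<Delta>) / D / N ^ (p + q) - M\<bar> = \<bar>S - K * M - \<Delta>\<bar> / K" using K by simp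
    also have "\<dots> \<le> K * ((1 + b / a) * C / N ^ 2 + ((1 + b / a) * gap_moment b N n 1 - 1)) / K"
    proof (rule divide_right_mono)
      have "\<bar>S - K * M - \<Delta>\<bar> \<le> \<bar>S - K * M\<bar> + \<bar>\<Delta>\<bar>" by (rule abs_triangle_ineq4)
      also have "\<dots> \<le> K * ((1 + b / a) * C / N ^ 2) + K * ((1 + b / a) * gap_moment b N n 1 - 1)"
        using main \<Delta> unfolding K_def by (intro add_mono) (auto simp: mult.assoc)
      finally show "\<bar>S - K * M - \<Delta>\<bar> \<le> K * ((1 + b / a) * C / N ^ 2 + ((1 + b / a) * gap_moment b N n 1 - 1))"
        by (simp add: algebra_simps)
    qed (use K in simp)
    also have "\<dots> = (1 + b / a) * C / N ^ 2 + ((1 + b / a) * gap_moment b N n 1 - 1)" using K by simp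
    finally show ?thesis unfolding E M_def .
  qed
  thus ?thesis using C by blast
qed

section \<open>First-order expansions\<close>

definition first_order :: "nat filter \<Rightarrow> (nat \<Rightarrow> real) \<Rightarrow> real \<Rightarrow> bool" where
  "first_order F f \<alpha> \<longleftrightarrow> (\<lambda>m. f m - (1 + \<alpha> / real m)) \<in> O[F](\<lambda>m. 1 / real m ^ 2)"

lemma inverse_nat_bigo_1: "(\<lambda>m. \<alpha> / real m) \<in> O[F](\<lambda>_. 1)"
proof (rule bigoI[of _ "\<bar>\<alpha>\<bar>"])
  have "\<bar>\<alpha> / real m\<bar> \<le> \<bar>\<alpha>\<bar>" for m
    by (cases "m = 0") (auto simp: field_simps intro: mult_le_cancel_left1[THEN iffD2])
  thus "\<forall>\<^sub>F m in F. norm (\<alpha> / real m) \<le> \<bar>\<alpha>\<bar> * norm (1 :: real)" by simp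
qed

lemma inverse_square_bigo_inverse: "(\<lambda>m. 1 / real m ^ 2) \<in> O[F](\<lambda>m. 1 / real m)"
  using landau_o.big.mult[OF inverse_nat_bigo_1[of 1 F] landau_o.big_refl[of "\<lambda>m. 1 / real m" F]]
  by (simp add: power2_eq_square)

lemma inverse_nat_bigo_inverse: "(\<lambda>m. \<alpha> / real m) \<in> O[F](\<lambda>m. 1 / real m)"
  by (rule bigoI[of _ "\<bar>\<alpha>\<bar>"]) simp

lemma inverse_square_bigo: "(\<lambda>m. \<alpha> / real m ^ 2) \<in> O[F](\<lambda>m. 1 / real m ^ 2)"
  by (rule bigoI[of _ "\<bar>\<alpha>\<bar>"]) simp

lemma first_order_minus_one:
  assumes "first_order F f \<alpha>"
  shows "(\<lambda>m. f m - 1) \<in> O[F](\<lambda>m. 1 / real m)"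
proof -
  have "(\<lambda>m. f m - (1 + \<alpha> / real m)) \<in> O[F](\<lambda>m. 1 / real m)"
    using assms inverse_square_bigo_inverse unfolding first_order_def by (rule landau_o.big_trans)
  from sum_in_bigo(1)[OF this inverse_nat_bigo_inverse[of \<alpha>]] show ?thesis by simp
qed

lemma first_order_bounded:
  assumes "first_order F f \<alpha>"
  shows "f \<in> O[F](\<lambda>_. 1)"
proof -
  have "(\<lambda>m. f m - 1) \<in> O[F](\<lambda>_. 1)"
    using first_order_minus_one[OF assms] inverse_nat_bigo_1 by (rule landau_o.big_trans)
  from sum_in_bigo(1)[OF this bigo_const[of 1]] show ?thesis by simp
qed

lemma first_order_mult:
  assumes f: "first_order F f \<alpha>" and g: "first_order F g \<beta>"
  shows "first_order F (\<lambda>m. f m * g m) (\<alpha> + \<beta>)"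
proof -
  have "(\<lambda>m. (f m - (1 + \<alpha> / real m)) * g m) \<in> O[F](\<lambda>m. 1 / real m ^ 2)"
    using landau_o.big.mult[OF f[unfolded first_order_def] first_order_bounded[OF g]] by simp
  moreover have "(\<lambda>m. (1 + \<alpha> / real m) * (g m - (1 + \<beta> / real m))) \<in> O[F](\<lambda>m. 1 / real m ^ 2)"
    using landau_o.big.mult[OF sum_in_bigo(1)[OF bigo_const[of 1] inverse_nat_bigo_1[of \<alpha>]] g[unfolded first_order_def]]
    by simp
  ultimately have "(\<lambda>m. (f m - (1 + \<alpha> / real m)) * g m + (1 + \<alpha> / real m) * (g m - (1 + \<beta> / real m)) +
      \<alpha> * \<beta> / real m ^ 2) \<in> O[F](\<lambda>m. 1 / real m ^ 2)"
    by (intro sum_in_bigo inverse_square_bigo)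
  thus ?thesis unfolding first_order_def by (simp add: algebra_simps power2_eq_square add_divide_distrib)
qed

lemma first_order_power:
  assumes "first_order F f \<alpha>"
  shows "first_order F (\<lambda>m. f m ^ s) (real s * \<alpha>)"
proof (induction s)
  case 0
  show ?case by (simp add: first_order_def)
next
  case (Suc s)
  from first_order_mult[OF assms Suc] show ?case by (simp add: algebra_simps)
qed

lemma first_order_perturb:
  assumes "first_order F f \<alpha>" "(\<lambda>m. g m - f m) \<in> O[F](\<lambda>m. 1 / real m ^ 2)"
  shows "first_order F g \<alpha>"
proof -
  have "(\<lambda>m. (g m - f m) + (f m - (1 + \<alpha> / real m))) \<in> O[F](\<lambda>m. 1 / real m ^ 2)"
    using sum_in_bigo(1)[OF assms(2) assms(1)[unfolded first_order_def]] .
  moreover have "(g m - f m) + (f m - (1 + \<alpha> / real m)) = g m - (1 + \<alpha> / real m)" for m by simp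
  ultimately show ?thesis unfolding first_order_def by (simp only:)
qed

text \<open>
  Here \<open>h\<close> is of order \<open>1 / m\<close>, so of \<open>g\<close> only the leading term \<open>1\<close> matters.
\<close>

lemma first_order_add_lower_order:
  assumes f: "first_order F f \<alpha>" and g: "first_order F g \<beta>" and h: "first_order F (\<lambda>m. h m * real m) \<gamma>"
    and F: "F \<le> at_top"
  shows "first_order F (\<lambda>m. f m + \<kappa> * h m * g m) (\<alpha> + \<kappa>)"
proof -
  from first_order_mult[OF h g] have "(\<lambda>m. h m * real m * g m - 1) \<in> O[F](\<lambda>m. 1 / real m)"
    by (rule first_order_minus_one)
  hence "(\<lambda>m. (h m * real m * g m - 1) * (\<kappa> / real m)) \<in> O[F](\<lambda>m. 1 / real m * (1 / real m))"
    using inverse_nat_bigo_inverse by (rule landau_o.big.mult)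
  hence "(\<lambda>m. (h m * real m * g m - 1) * (\<kappa> / real m)) \<in> O[F](\<lambda>m. 1 / real m ^ 2)"
    by (simp add: power2_eq_square)
  from sum_in_bigo(1)[OF f[unfolded first_order_def] this]
  have sum: "(\<lambda>m. f m - (1 + \<alpha> / real m) + (h m * real m * g m - 1) * (\<kappa> / real m)) \<in> O[F](\<lambda>m. 1 / real m ^ 2)" .
  have "\<forall>\<^sub>F m in F. m > 0" using F eventually_gt_at_top by (rule filter_leD)
  hence "\<forall>\<^sub>F m in F. f m - (1 + \<alpha> / real m) + (h m * real m * g m - 1) * (\<kappa> / real m) =
      f m + \<kappa> * h m * g m - (1 + (\<alpha> + \<kappa>) / real m)"
    by eventually_elim (simp add: field_simps)
  from landau_o.big.in_cong[OF this] sum show ?thesis unfolding first_order_def by blast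
qed

text \<open>
  The sequence that remains after removing \<open>j\<close> entries has length \<open>n = m - j\<close>, and \<open>N - n b = c m + (j + 1) b\<close>.
  So \<open>T / N\<close> has mean \<open>b / (N - n b) + O(1 / m\<^sup>2) = b / (c m) + O(1 / m\<^sup>2)\<close>, whatever \<open>j\<close> is, and the mean
  of \<open>(T / N)\<^sup>2\<close> is \<open>O(1 / m\<^sup>2)\<close>.
\<close>

lemma first_order_gap_moment:
  fixes b :: nat and c :: real
  assumes b: "b \<ge> 1" and c: "c > 0" and F: "F \<le> at_top" and j: "j \<in> {1, 2}"
  shows "first_order F (\<lambda>m. gap_moment b ((real b + c) * real m + real b) (m - j) s) (- (real s * b / c))"
  unfolding first_order_def
proof (rule landau_o.big.filter_mono[OF F])
  define K where "K = real s * (3 * real b ^ 2 / c ^ 2 + real b ^ 3 / c ^ 3) + real s ^ 2 * (real b ^ 2 * (2 * real b + c) / c ^ 3)"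
  show "(\<lambda>m. gap_moment b ((real b + c) * real m + real b) (m - j) s - (1 + - (real s * b / c) / real m))
    \<in> O(\<lambda>m. 1 / real m ^ 2)"
  proof (rule bigoI[of _ K])
    show "\<forall>\<^sub>F m in sequentially. norm (gap_moment b ((real b + c) * real m + real b) (m - j) s -
      (1 + - (real s * b / c) / real m)) \<le> K * norm (1 / real m ^ 2)"
      using eventually_ge_at_top[of 2]
    proof eventually_elim
      case (elim m)
      define N where "N = (real b + c) * real m + real b"
      define n where "n = m - j"
      define x where "x = real m"
      define B where "B = real b"
      have x: "x \<ge> 2" and B: "B \<ge> 1" using elim b by (auto simp: x_def B_def)
      have n: "real n = x - real j" "real n \<ge> 0" "real n \<le> x" using elim j by (auto simp: n_def x_def)
      define d where "d = c * x + (real j + 1) * B"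
      have d_eq: "N - real n * B = d" by (simp add: N_def d_def n(1) x_def B_def algebra_simps)
      have cx: "c * x > 0" using c x by simp
      have d: "d > 0" "c * x \<le> d" using cx B by (auto simp: d_def add_pos_nonneg)
      have dle: "d - c * x \<le> 3 * B" using j B by (auto simp: d_def)
      have N: "N > 0" using d_eq d n B by (smt (verit) mult_nonneg_nonneg)
      have N_le: "N \<le> (2 * B + c) * x"
      proof -
        have "B * 1 \<le> B * x" using B x by (intro mult_left_mono) auto
        thus ?thesis by (simp add: N_def x_def B_def algebra_simps)
      qed
      have nB: "real n * B < N" "(real n + 1) * B \<le> N"
      proof -
        show "real n * B < N" using d_eq d by simp
        have "B \<le> d" using j B cx by (auto simp: d_def)
        thus "(real n + 1) * B \<le> N" using d_eq by (simp add: algebra_simps)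
      qed
      define g1 where "g1 = gap_mean B N n (\<lambda>t. t) / N"
      define g2 where "g2 = gap_mean B N n (\<lambda>t. t ^ 2) / N ^ 2"
      have B0: "B > 0" using B by simp
      have g1_le: "g1 \<le> B / d"
      proof -
        have "g1 \<le> B * N / d / N"
          using gap_mean_id_bounds(1)[OF B0 nB(1)] N unfolding g1_def d_eq by (intro divide_right_mono) auto
        thus ?thesis using N by simp
      qed
      have g1_ge: "B / d - real n * B ^ 3 / d ^ 3 \<le> g1"
      proof -
        have "(B * N / d - real n * B ^ 3 * N / d ^ 3) / N \<le> g1"
          using gap_mean_id_bounds(2)[OF B0 nB(1)] N unfolding g1_def d_eq by (intro divide_right_mono) auto
        thus ?thesis using N by (simp add: diff_divide_distrib)
      qed
      have t1: "B / (c * x) - B / d \<le> 3 * B ^ 2 / c ^ 2 / x ^ 2" "B / d \<le> B / (c * x)"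
      proof -
        have "B / (c * x) - B / d = B * (d - c * x) / (c * x * d)" using d c x by (simp add: divide_simps right_diff_distrib)
        also have "\<dots> \<le> B * (3 * B) / (c * x * (c * x))"
          using d cx dle B by (intro frac_le mult_mono mult_left_mono) auto
        finally show "B / (c * x) - B / d \<le> 3 * B ^ 2 / c ^ 2 / x ^ 2" by (simp add: power2_eq_square mult_ac)
        show "B / d \<le> B / (c * x)" using d cx B by (intro divide_left_mono) auto
      qed
      have t2: "real n * B ^ 3 / d ^ 3 \<le> B ^ 3 / c ^ 3 / x ^ 2"
      proof -
        have "real n * B ^ 3 / d ^ 3 \<le> x * B ^ 3 / (c * x) ^ 3"
          using n B d cx x c by (intro frac_le mult_right_mono power_mono mult_nonneg_nonneg zero_less_power) auto
        also have "\<dots> = B ^ 3 / c ^ 3 / x ^ 2" using x c by (simp add: power_mult_distrib power2_eq_square power3_eq_cube mult_ac)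
        finally show ?thesis .
      qed
      have t3: "g2 \<le> B ^ 2 * (2 * B + c) / c ^ 3 / x ^ 2"
      proof -
        have "g2 \<le> B ^ 2 * (N / d) ^ 3 / N ^ 2"
          using gap_mean_square_bound[OF B0 nB(1)] N unfolding g2_def d_eq by (intro divide_right_mono) auto
        also have "\<dots> = B ^ 2 * N / d ^ 3"
          using N d by (simp add: power2_eq_square power3_eq_cube)
        also have "\<dots> \<le> B ^ 2 * ((2 * B + c) * x) / (c * x) ^ 3"
          using N N_le B d cx x c by (intro frac_le mult_left_mono power_mono mult_nonneg_nonneg zero_less_power) auto
        also have "\<dots> = B ^ 2 * (2 * B + c) / c ^ 3 / x ^ 2"
          using x c by (simp add: power_mult_distrib power2_eq_square power3_eq_cube mult_ac)
        finally show ?thesis .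
      qed
      have "\<bar>g1 - B / (c * x)\<bar> \<le> (3 * B ^ 2 / c ^ 2 + B ^ 3 / c ^ 3) / x ^ 2"
        using g1_le g1_ge t1 t2 B cx c x unfolding abs_le_iff add_divide_distrib
        by (smt (verit) divide_nonneg_pos zero_le_power zero_less_power divide_nonneg_nonneg)
      hence u1: "real s * \<bar>g1 - B / (c * x)\<bar> \<le> real s * (3 * B ^ 2 / c ^ 2 + B ^ 3 / c ^ 3) / x ^ 2"
        using mult_left_mono[of _ _ "real s"] by fastforce
      have u2: "real s ^ 2 * g2 \<le> real s ^ 2 * (B ^ 2 * (2 * B + c) / c ^ 3) / x ^ 2"
        using mult_left_mono[OF t3, of "real s ^ 2"] by simp
      have "\<bar>gap_moment B N n s - (1 - real s * g1)\<bar> \<le> real s ^ 2 * g2"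
        using gap_moment_expansion[OF B0 nB(2)] by (simp add: g1_def g2_def)
      moreover have "\<bar>real s * g1 - real s * (B / (c * x))\<bar> = real s * \<bar>g1 - B / (c * x)\<bar>"
        unfolding right_diff_distrib[symmetric] abs_mult by simp
      ultimately have "\<bar>gap_moment B N n s - (1 - real s * (B / (c * x)))\<bar> \<le> K / x ^ 2"
        using u1 u2 unfolding K_def B_def[symmetric] add_divide_distrib[of "real s * _"] by (smt (verit))
      thus ?case by (simp add: N_def n_def x_def B_def)
    qed
  qed
qed

lemma first_order_shift:
  assumes \<beta>: "\<beta> > 0" and F: "F \<le> at_top"
  shows "first_order F (\<lambda>m. (\<beta> * real m + \<delta>) / (\<beta> * real m)) (\<delta> / \<beta>)"
proof -
  have "\<forall>\<^sub>F m in F. m > 0" using F eventually_gt_at_top by (rule filter_leD)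
  hence "\<forall>\<^sub>F m in F. (\<beta> * real m + \<delta>) / (\<beta> * real m) - (1 + \<delta> / \<beta> / real m) = 0"
    by eventually_elim (use \<beta> in \<open>simp add: field_simps\<close>)
  from landau_o.big.in_cong[OF this] show ?thesis unfolding first_order_def by simp
qed

lemma first_order_inverse_shift:
  assumes \<beta>: "\<beta> > 0" and \<delta>: "\<delta> \<ge> 0" and F: "F \<le> at_top"
  shows "first_order F (\<lambda>m. \<beta> / (\<beta> * real m + \<delta>) * real m) (- (\<delta> / \<beta>))"
  unfolding first_order_def
proof (rule landau_o.big.filter_mono[OF F], rule bigoI[of _ "(\<delta> / \<beta>) ^ 2"])
  show "\<forall>\<^sub>F m in sequentially. norm (\<beta> / (\<beta> * real m + \<delta>) * real m - (1 + - (\<delta> / \<beta>) / real m))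
      \<le> (\<delta> / \<beta>) ^ 2 * norm (1 / real m ^ 2)"
    using eventually_gt_at_top[of 0]
  proof eventually_elim
    case (elim m)
    define x where "x = real m"
    have x: "x > 0" using elim by (simp add: x_def)
    define d where "d = \<beta> * x + \<delta>"
    have d: "d > 0" "\<beta> * x \<le> d" "\<beta> * x > 0" using \<beta> \<delta> x by (auto simp: d_def add_pos_nonneg)
    have "\<beta> / d * x - (1 + - (\<delta> / \<beta>) / x) = \<delta> ^ 2 / (\<beta> * x * d)"
      using \<beta> x d(1) by (simp add: field_simps) (simp add: d_def power2_eq_square algebra_simps)
    moreover have "\<delta> ^ 2 / (\<beta> * x * d) \<le> \<delta> ^ 2 / (\<beta> * x * (\<beta> * x))"
      using d by (intro divide_left_mono mult_left_mono) auto
    moreover have "0 \<le> \<delta> ^ 2 / (\<beta> * x * d)" using d by simp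
    ultimately have "\<bar>\<beta> / d * x - (1 + - (\<delta> / \<beta>) / x)\<bar> \<le> \<delta> ^ 2 / (\<beta> * x * (\<beta> * x))" by linarith
    also have "\<dots> = (\<delta> / \<beta>) ^ 2 * (1 / x ^ 2)" by (simp add: power2_eq_square)
    finally show ?case unfolding d_def x_def by simp
  qed
qed

lemma eventually_at_top_int_mult: "\<forall>\<^sub>F m in at_top_int_mult c. c * real m \<in> \<int>"
  by (simp add: at_top_int_mult_def eventually_inf_principal)

lemma at_top_int_mult_le: "at_top_int_mult c \<le> at_top"
  by (simp add: at_top_int_mult_def)

text \<open>
  Since \<open>a = c m + b\<close> is determined by \<open>m\<close>, the remainder can be defined as a function of \<open>m\<close> alone, as the exact
  error for this \<open>a\<close>.
\<close>

lemma remainder_exists: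
  fixes X :: "nat \<Rightarrow> nat \<Rightarrow> real" and \<beta> :: real
  assumes \<beta>: "\<beta> > 0" and D: "D > 0" and c: "c > 0"
    and fo: "first_order F (\<lambda>m. D * X (nat \<lfloor>c * real m\<rfloor> + b) m / (\<beta> * real m) ^ p) \<alpha>"
  shows "\<exists>R. R \<in> O[F](\<lambda>m. 1 / real m ^ 2) \<and> (\<forall>m a. m \<ge> 1 \<and> real a = c * real m + real b \<longrightarrow>
    X a m = (\<beta> * real m) ^ p / D * (1 + \<alpha> / real m + R m))"
proof (intro exI conjI allI impI)
  let ?R = "\<lambda>m. D * X (nat \<lfloor>c * real m\<rfloor> + b) m / (\<beta> * real m) ^ p - (1 + \<alpha> / real m)"
  show "?R \<in> O[F](\<lambda>m. 1 / real m ^ 2)" using fo unfolding first_order_def .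
  fix m a :: nat assume m: "m \<ge> 1 \<and> real a = c * real m + real b"
  have "real b \<le> real a" using m c by simp
  moreover from this have "c * real m = of_nat (a - b)" using m by (simp add: of_nat_diff)
  ultimately have "a = nat \<lfloor>c * real m\<rfloor> + b" by (simp only: floor_of_nat nat_int)
  note a = this
  show "X a m = (\<beta> * real m) ^ p / D * (1 + \<alpha> / real m + ?R m)" unfolding a[symmetric] using \<beta> D m by simp
qed

section \<open>The two expansions\<close>

text \<open>
  With \<open>N / ((b + c) m) = 1 + b / ((b + c) m)\<close>, the coefficient of \<open>1 / m\<close> is the sum of \<open>p b / (b + c)\<close> from
  \<open>N\<^sup>p\<close>, of \<open>- p b / c\<close> from the gap moment, and of \<open>(p + 1) / (2 (b + c))\<close> from the second term of the power sum.
\<close>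

lemma expectation_first_first_order:
  fixes b p :: nat and c :: real
  assumes p: "p \<ge> 1" and b: "b \<ge> 1" and c: "c > 0"
  shows "first_order (at_top_int_mult c)
    (\<lambda>m. (real p + 1) * pf_expectation (nat \<lfloor>c * real m\<rfloor> + b) b m (\<lambda>\<pi>. real (\<pi> ! 0) ^ p) / ((real b + c) * real m) ^ p)
    (1 / (c * (real b + c)) * (c * (real p + 1) / 2 - real b ^ 2 * real p))"
proof -
  define F where "F = at_top_int_mult c"
  have F: "F \<le> at_top" unfolding F_def by (rule at_top_int_mult_le)
  define \<beta> where "\<beta> = real b + c"
  have \<beta>: "\<beta> > 0" using c by (simp add: \<beta>_def add_nonneg_pos)
  define N where "N m = \<beta> * real m + real b" for m
  define E where "E m = pf_expectation (nat \<lfloor>c * real m\<rfloor> + b) b m (\<lambda>\<pi>. real (\<pi> ! 0) ^ p)" for m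
  define G where "G s m = gap_moment b (N m) (m - 1) s" for s m
  have G: "first_order F (G s) (- (real s * b / c))" for s
    using first_order_gap_moment[OF b c F, of 1 s] unfolding G_def N_def \<beta>_def by simp
  obtain C where approx: "\<And>a n N. a \<ge> 1 \<Longrightarrow> N = real a + (real n + 1) * real b \<Longrightarrow>
    \<bar>pf_expectation a b (Suc n) (\<lambda>\<pi>. real (\<pi> ! 0) ^ p) / N ^ p -
       (gap_moment b N n p / (real p + 1) + gap_moment b N n (p - 1) / (2 * N))\<bar> \<le> C / N ^ 2"
    using expectation_first_approx[OF p b] by metis
  have ev: "\<forall>\<^sub>F m in F. m > 0" "\<forall>\<^sub>F m in F. c * real m \<in> \<int>"
    using filter_leD[OF F eventually_gt_at_top] eventually_at_top_int_mult unfolding F_def by auto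
  have "first_order F (\<lambda>m. G p m + (real p + 1) / (2 * \<beta>) * (\<beta> / N m) * G (p - 1) m)
    (- (real p * b / c) + (real p + 1) / (2 * \<beta>))"
    by (rule first_order_add_lower_order[OF G G _ F])
      (use first_order_inverse_shift[OF \<beta> _ F, of "real b"] in \<open>simp add: N_def\<close>)
  hence "first_order F (\<lambda>m. (real p + 1) * (E m / N m ^ p)) (- (real p * b / c) + (real p + 1) / (2 * \<beta>))"
  proof (rule first_order_perturb, intro bigoI[of _ "(real p + 1) * \<bar>C\<bar> / \<beta> ^ 2"])
    show "\<forall>\<^sub>F m in F. norm ((real p + 1) * (E m / N m ^ p) -
      (G p m + (real p + 1) / (2 * \<beta>) * (\<beta> / N m) * G (p - 1) m))
      \<le> (real p + 1) * \<bar>C\<bar> / \<beta> ^ 2 * norm (1 / real m ^ 2)"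
      using ev
    proof eventually_elim
      case (elim m)
      define a where "a = nat \<lfloor>c * real m\<rfloor> + b"
      have a: "a \<ge> 1" "real a = c * real m + real b" using elim b c by (auto simp: a_def elim!: Ints_cases)
      have Nm: "N m = real a + (real (m - 1) + 1) * real b"
        using elim by (simp add: N_def \<beta>_def a(2) algebra_simps of_nat_diff)
      have N_ge: "\<beta> * real m \<le> N m" "\<beta> * real m > 0" using \<beta> elim by (auto simp: N_def)
      have bound: "\<bar>E m / N m ^ p - (G p m / (real p + 1) + G (p - 1) m / (2 * N m))\<bar> \<le> C / N m ^ 2"
        using approx[OF a(1) Nm] elim unfolding E_def a_def[symmetric] G_def by simp
      have "(real p + 1) * (E m / N m ^ p) - (G p m + (real p + 1) / (2 * \<beta>) * (\<beta> / N m) * G (p - 1) m) =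
        (real p + 1) * (E m / N m ^ p - (G p m / (real p + 1) + G (p - 1) m / (2 * N m)))"
        using \<beta> by (simp add: right_diff_distrib distrib_left)
      hence "\<bar>(real p + 1) * (E m / N m ^ p) - (G p m + (real p + 1) / (2 * \<beta>) * (\<beta> / N m) * G (p - 1) m)\<bar> =
        (real p + 1) * \<bar>E m / N m ^ p - (G p m / (real p + 1) + G (p - 1) m / (2 * N m))\<bar>"
        by (simp add: abs_mult)
      also have "\<dots> \<le> (real p + 1) * (\<bar>C\<bar> / (\<beta> * real m) ^ 2)"
      proof (rule mult_left_mono)
        have "C / N m ^ 2 \<le> \<bar>C\<bar> / (\<beta> * real m) ^ 2"
          using N_ge by (intro frac_le power_mono zero_less_power) auto
        thus "\<bar>E m / N m ^ p - (G p m / (real p + 1) + G (p - 1) m / (2 * N m))\<bar> \<le> \<bar>C\<bar> / (\<beta> * real m) ^ 2"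
          using bound by linarith
      qed simp
      also have "\<dots> = (real p + 1) * \<bar>C\<bar> / \<beta> ^ 2 * norm (1 / real m ^ 2)"
        by (simp add: power_mult_distrib)
      finally show ?case by simp
    qed
  qed
  from first_order_mult[OF first_order_power[OF first_order_shift[OF \<beta> F, of "real b"], of p] this]
  have "first_order F (\<lambda>m. (N m / (\<beta> * real m)) ^ p * ((real p + 1) * (E m / N m ^ p)))
     (real p * (b / \<beta>) + (- (real p * b / c) + (real p + 1) / (2 * \<beta>)))" unfolding N_def .
  also have "real p * (b / \<beta>) + (- (real p * b / c) + (real p + 1) / (2 * \<beta>)) =
      1 / (c * \<beta>) * (c * (real p + 1) / 2 - real b ^ 2 * real p)"
    using c \<beta> by (simp add: field_simps) (simp add: \<beta>_def algebra_simps power2_eq_square)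
  finally have "first_order F (\<lambda>m. (N m / (\<beta> * real m)) ^ p * ((real p + 1) * (E m / N m ^ p)))
      (1 / (c * \<beta>) * (c * (real p + 1) / 2 - real b ^ 2 * real p))" .
  moreover have "(N m / (\<beta> * real m)) ^ p * ((real p + 1) * (E m / N m ^ p)) = (real p + 1) * E m / (\<beta> * real m) ^ p" for m
  proof -
    have "N m > 0" using \<beta> b by (simp add: N_def add_nonneg_pos)
    thus ?thesis by (simp add: power_divide)
  qed
  ultimately show ?thesis unfolding F_def E_def \<beta>_def by simp
qed

text \<open>
  The factor \<open>r = 1 + b / a\<close>, which is \<open>N\<close> times the number of parking functions for \<open>a + b, b, m - 1\<close> divided by
  the number for \<open>a, b, m\<close>, contributes \<open>b / c\<close>. This makes up for the gap moment having order \<open>p + q + 1\<close> instead of \<open>p + q\<close>, and it makes the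
  contribution of the missing corner vanish to first order.
\<close>

lemma expectation_first_two_first_order:
  fixes b p q :: nat and c :: real
  assumes p: "p \<ge> 1" and q: "q \<ge> 1" and b: "b \<ge> 1" and c: "c > 0"
  shows "first_order (at_top_int_mult c)
    (\<lambda>m. (real p + 1) * (real q + 1) *
       pf_expectation (nat \<lfloor>c * real m\<rfloor> + b) b m (\<lambda>\<pi>. real (\<pi> ! 0) ^ p * real (\<pi> ! 1) ^ q) /
       ((real b + c) * real m) ^ (p + q))
    (1 / (c * (real b + c)) * (c * (real p + real q + 2) / 2 - real b ^ 2 * (real p + real q)))"
proof -
  define F where "F = at_top_int_mult c"
  have F: "F \<le> at_top" unfolding F_def by (rule at_top_int_mult_le)
  define \<beta> where "\<beta> = real b + c"
  have \<beta>: "\<beta> > 0" using c by (simp add: \<beta>_def add_nonneg_pos)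
  define N where "N m = \<beta> * real m + real b" for m
  define E where "E m = pf_expectation (nat \<lfloor>c * real m\<rfloor> + b) b m (\<lambda>\<pi>. real (\<pi> ! 0) ^ p * real (\<pi> ! 1) ^ q)" for m
  define G where "G s m = gap_moment b (N m) (m - 2) s" for s m
  define D where "D = (real p + 1) * (real q + 1)"
  have D: "D > 0" by (simp add: D_def)
  define r where "r m = 1 + real b / (c * real m + real b)" for m
  have G: "first_order F (G s) (- (real s * b / c))" for s
    using first_order_gap_moment[OF b c F, of 2 s] unfolding G_def N_def \<beta>_def by simp
  have r: "first_order F r (b / c)"
  proof -
    have one: "first_order F (\<lambda>_. 1) 0" by (simp add: first_order_def)
    have "first_order F (\<lambda>m. 1 + b / c * (c / (c * real m + real b)) * 1) (0 + b / c)"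
      by (rule first_order_add_lower_order[OF one one first_order_inverse_shift[OF c _ F] F]) simp
    thus ?thesis using c unfolding r_def by simp
  qed
  obtain C where approx: "\<And>a n N. a \<ge> 1 \<Longrightarrow> N = real a + (real n + 2) * real b \<Longrightarrow>
    \<bar>pf_expectation a b (Suc (Suc n)) (\<lambda>\<pi>. real (\<pi> ! 0) ^ p * real (\<pi> ! 1) ^ q) / N ^ (p + q) -
       (1 + b / a) * (gap_moment b N n (p + q + 1) + real (p + q + 2) / (2 * N) * gap_moment b N n (p + q)) / D\<bar>
      \<le> (1 + b / a) * C / N ^ 2 + ((1 + b / a) * gap_moment b N n 1 - 1)"
    using expectation_first_two_approx[OF p q b] unfolding D_def[symmetric] by blast
  have ev: "\<forall>\<^sub>F m in F. m \<ge> 2" "\<forall>\<^sub>F m in F. c * real m \<in> \<int>"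
    using filter_leD[OF F eventually_ge_at_top] eventually_at_top_int_mult unfolding F_def by auto
  define err where "err m = D * (r m * C / N m ^ 2) + D * (r m * G 1 m - 1)" for m
  have inv: "first_order F (\<lambda>m. \<beta> / N m * real m) (- (b / \<beta>))"
    unfolding N_def by (rule first_order_inverse_shift[OF \<beta> _ F]) simp
  have err: "err \<in> O[F](\<lambda>m. 1 / real m ^ 2)"
  proof -
    \<comment> \<open>The contributions \<open>b / c\<close> and \<open>- b / c\<close> cancel.\<close>
    have "first_order F (\<lambda>m. r m * G 1 m) 0" using first_order_mult[OF r G[of 1]] by simp
    hence "(\<lambda>m. r m * G 1 m - 1) \<in> O[F](\<lambda>m. 1 / real m ^ 2)" by (simp add: first_order_def)
    hence e1: "(\<lambda>m. D * (r m * G 1 m - 1)) \<in> O[F](\<lambda>m. 1 / real m ^ 2)" using D by simp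
    have "(\<lambda>m. D * C / \<beta> ^ 2 / real m ^ 2 * (r m * (\<beta> / N m * real m * (\<beta> / N m * real m)))) \<in>
        O[F](\<lambda>m. 1 / real m ^ 2 * 1)"
      by (intro landau_o.big.mult[OF inverse_square_bigo] first_order_bounded[OF first_order_mult[OF r first_order_mult[OF inv inv]]])
    moreover have "\<forall>\<^sub>F m in F. D * C / \<beta> ^ 2 / real m ^ 2 * (r m * (\<beta> / N m * real m * (\<beta> / N m * real m))) =
        D * (r m * C / N m ^ 2)"
      using ev(1) by eventually_elim (use \<beta> in \<open>simp add: power2_eq_square\<close>)
    ultimately have "(\<lambda>m. D * (r m * C / N m ^ 2)) \<in> O[F](\<lambda>m. 1 / real m ^ 2 * 1)"
      by (subst (asm) landau_o.big.in_cong)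
    hence "(\<lambda>m. D * (r m * C / N m ^ 2)) \<in> O[F](\<lambda>m. 1 / real m ^ 2)" unfolding mult_1_right .
    from sum_in_bigo(1)[OF this e1] show ?thesis unfolding err_def[abs_def] .
  qed
  have "first_order F (\<lambda>m. G (p + q + 1) m + real (p + q + 2) / (2 * \<beta>) * (\<beta> / N m) * G (p + q) m)
    (- (real (p + q + 1) * b / c) + real (p + q + 2) / (2 * \<beta>))"
    by (rule first_order_add_lower_order[OF G G inv F])
  from first_order_mult[OF r this]
  have "first_order F (\<lambda>m. D * (E m / N m ^ (p + q)))
    (b / c + (- (real (p + q + 1) * b / c) + real (p + q + 2) / (2 * \<beta>)))"
  proof (rule first_order_perturb, intro landau_o.big_trans[OF bigoI[of _ 1] err])
    show "\<forall>\<^sub>F m in F. norm (D * (E m / N m ^ (p + q)) -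
      r m * (G (p + q + 1) m + real (p + q + 2) / (2 * \<beta>) * (\<beta> / N m) * G (p + q) m)) \<le> 1 * norm (err m)"
      using ev
    proof eventually_elim
      case (elim m)
      define a where "a = nat \<lfloor>c * real m\<rfloor> + b"
      have a: "a \<ge> 1" "real a = c * real m + real b" using elim b c by (auto simp: a_def elim!: Ints_cases)
      have Nm: "N m = real a + (real (m - 2) + 2) * real b"
        using elim by (simp add: N_def \<beta>_def a(2) algebra_simps of_nat_diff)
      have Suc: "Suc (Suc (m - 2)) = m" using elim by simp
      define M where "M = r m * (G (p + q + 1) m + real (p + q + 2) / (2 * N m) * G (p + q) m)"
      have bound: "\<bar>E m / N m ^ (p + q) - M / D\<bar> \<le> r m * C / N m ^ 2 + (r m * G 1 m - 1)"
        using approx[OF a(1) Nm] unfolding Suc E_def a_def[symmetric] G_def M_def r_def a(2)[symmetric] .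
      have "r m * (G (p + q + 1) m + real (p + q + 2) / (2 * \<beta>) * (\<beta> / N m) * G (p + q) m) = M"
        using \<beta> unfolding M_def by simp
      hence "D * (E m / N m ^ (p + q)) -
          r m * (G (p + q + 1) m + real (p + q + 2) / (2 * \<beta>) * (\<beta> / N m) * G (p + q) m) =
        D * (E m / N m ^ (p + q) - M / D)" using D by (simp add: right_diff_distrib)
      hence "norm (D * (E m / N m ^ (p + q)) -
          r m * (G (p + q + 1) m + real (p + q + 2) / (2 * \<beta>) * (\<beta> / N m) * G (p + q) m)) =
        D * \<bar>E m / N m ^ (p + q) - M / D\<bar>" using D by (simp add: abs_mult)
      also have "\<dots> \<le> D * (r m * C / N m ^ 2 + (r m * G 1 m - 1))"
        using bound D by (intro mult_left_mono) auto
      also have "\<dots> = err m" by (simp only: err_def distrib_left)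
      finally show ?case by simp
    qed
  qed
  from first_order_mult[OF first_order_power[OF first_order_shift[OF \<beta> F, of "real b"], of "p + q"] this]
  have "first_order F (\<lambda>m. (N m / (\<beta> * real m)) ^ (p + q) * (D * (E m / N m ^ (p + q))))
     (real (p + q) * (b / \<beta>) + (b / c + (- (real (p + q + 1) * b / c) + real (p + q + 2) / (2 * \<beta>))))"
    unfolding N_def .
  also have "real (p + q) * (b / \<beta>) + (b / c + (- (real (p + q + 1) * b / c) + real (p + q + 2) / (2 * \<beta>))) =
      1 / (c * \<beta>) * (c * (real p + real q + 2) / 2 - real b ^ 2 * (real p + real q))"
    using c \<beta> by (simp add: field_simps) (simp add: \<beta>_def algebra_simps power2_eq_square)
  finally have "first_order F (\<lambda>m. (N m / (\<beta> * real m)) ^ (p + q) * (D * (E m / N m ^ (p + q))))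
      (1 / (c * \<beta>) * (c * (real p + real q + 2) / 2 - real b ^ 2 * (real p + real q)))" .
  moreover have "(N m / (\<beta> * real m)) ^ (p + q) * (D * (E m / N m ^ (p + q))) = D * E m / (\<beta> * real m) ^ (p + q)" for m
  proof -
    have "N m > 0" using \<beta> b by (simp add: N_def add_nonneg_pos)
    thus ?thesis by (simp add: power_divide)
  qed
  ultimately show ?thesis unfolding F_def E_def \<beta>_def D_def by simp
qed

theorem theorem3p3:
  fixes p q b :: nat and c :: real
  assumes "p \<ge> 1" and "q \<ge> 1" and "b \<ge> 1" and "c > 0"
  shows "(\<exists>R :: nat \<Rightarrow> real. R \<in> O[at_top_int_mult c](\<lambda>m. 1 / real m ^ 2) \<and>
            (\<forall>m a :: nat. m \<ge> 1 \<and> real a = c * real m + real b \<longrightarrow>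
               pf_expectation a b m (\<lambda>\<pi>. real (\<pi> ! 0) ^ p) =
                 ((real b + c) * real m) ^ p / (real p + 1) *
                 (1 + 1 / (c * (real b + c) * real m) *
                        (c * (real p + 1) / 2 - real b ^ 2 * real p) + R m))) \<and>
         (\<exists>R :: nat \<Rightarrow> real. R \<in> O[at_top_int_mult c](\<lambda>m. 1 / real m ^ 2) \<and>
            (\<forall>m a :: nat. m \<ge> 2 \<and> real a = c * real m + real b \<longrightarrow>
               pf_expectation a b m (\<lambda>\<pi>. real (\<pi> ! 0) ^ p * real (\<pi> ! 1) ^ q) =
                 ((real b + c) * real m) ^ (p + q) / ((real p + 1) * (real q + 1)) *
                 (1 + 1 / (c * (real b + c) * real m) *
                        (c * (real p + real q + 2) / 2 - real b ^ 2 * (real p + real q)) + R m)))"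
proof (intro conjI)
  have \<beta>: "real b + c > 0" using assms by simp
  obtain R where R: "R \<in> O[at_top_int_mult c](\<lambda>m. 1 / real m ^ 2)" and
    eq: "\<And>m a. m \<ge> 1 \<and> real a = c * real m + real b \<Longrightarrow>
      pf_expectation a b m (\<lambda>\<pi>. real (\<pi> ! 0) ^ p) = ((real b + c) * real m) ^ p / (real p + 1) *
        (1 + (1 / (c * (real b + c)) * (c * (real p + 1) / 2 - real b ^ 2 * real p)) / real m + R m)"
    using remainder_exists[where X = "\<lambda>a m. pf_expectation a b m (\<lambda>\<pi>. real (\<pi> ! 0) ^ p)" and D = "real p + 1",
      OF \<beta> _ assms(4) expectation_first_first_order[OF assms(1,3,4)]] by auto
  show "\<exists>R :: nat \<Rightarrow> real. R \<in> O[at_top_int_mult c](\<lambda>m. 1 / real m ^ 2) \<and>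
            (\<forall>m a :: nat. m \<ge> 1 \<and> real a = c * real m + real b \<longrightarrow>
               pf_expectation a b m (\<lambda>\<pi>. real (\<pi> ! 0) ^ p) =
                 ((real b + c) * real m) ^ p / (real p + 1) *
                 (1 + 1 / (c * (real b + c) * real m) *
                        (c * (real p + 1) / 2 - real b ^ 2 * real p) + R m))"
    using R eq by (intro exI[of _ R] conjI allI impI) simp_all
  obtain R where R: "R \<in> O[at_top_int_mult c](\<lambda>m. 1 / real m ^ 2)" and
    eq: "\<And>m a. m \<ge> 1 \<and> real a = c * real m + real b \<Longrightarrow>
      pf_expectation a b m (\<lambda>\<pi>. real (\<pi> ! 0) ^ p * real (\<pi> ! 1) ^ q) =
        ((real b + c) * real m) ^ (p + q) / ((real p + 1) * (real q + 1)) *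
        (1 + (1 / (c * (real b + c)) * (c * (real p + real q + 2) / 2 - real b ^ 2 * (real p + real q))) / real m + R m)"
    using remainder_exists[where X = "\<lambda>a m. pf_expectation a b m (\<lambda>\<pi>. real (\<pi> ! 0) ^ p * real (\<pi> ! 1) ^ q)"
        and D = "(real p + 1) * (real q + 1)",
      OF \<beta> _ assms(4) expectation_first_two_first_order[OF assms]] by auto
  show "\<exists>R :: nat \<Rightarrow> real. R \<in> O[at_top_int_mult c](\<lambda>m. 1 / real m ^ 2) \<and>
            (\<forall>m a :: nat. m \<ge> 2 \<and> real a = c * real m + real b \<longrightarrow>
               pf_expectation a b m (\<lambda>\<pi>. real (\<pi> ! 0) ^ p * real (\<pi> ! 1) ^ q) =
                 ((real b + c) * real m) ^ (p + q) / ((real p + 1) * (real q + 1)) *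
                 (1 + 1 / (c * (real b + c) * real m) *
                        (c * (real p + real q + 2) / 2 - real b ^ 2 * (real p + real q)) + R m))"
    using R eq by (intro exI[of _ R] conjI allI impI) simp_all
qed

end
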